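(* Let $X$ be a Banach space with the property that Pettis integrability and McShane integrability coincide for functions $[0,1]\to X$. Then for any Henstock (respectively, McShane) integrable multifunction $\Gamma:[0,1]\to cwk(X)$, every scalarly measurable selection of $\Gamma$ is Henstock (respectively, McShane) integrable.
   Context: $[0,1]$ carries Lebesgue measure; $|I|$ denotes the length of a closed subinterval $I$ of $[0,1]$. $cwk(X)$ is the family of all non-empty convex weakly compact subsets of $X$, with Minkowski addition, multiplication by scalars, and the Hausdorff distance $d_H$. A function $f:[0,1]\to X$ is a selection of $\Gamma$ if $f(t)\in\Gamma(t)$ for every $t\in[0,1]$; it is scalarly measurable if $x^*f$ is measurable for every $x^*\in X^*$. A gauge is a function $\delta:[0,1]\to(0,\infty)$. A partition of $[0,1]$ is a finite collection $\{(I_1,t_1),\dots,(I_p,t_p)\}$ of non-overlapping closed subintervals with union $[0,1]$ and points $t_i\in[0,1]$; it is a Perron partition if $t_i\in I_i$ for all $i$; it is $\delta$-fine if $I_i\subset(t_i-\delta(t_i),t_i+\delta(t_i))$ for all $i$. $\Gamma:[0,1]\to cwk(X)$ is Henstock (resp. McShane) integrable if there is a non-empty closed convex set $\Phi\subset X$ such that for every $\varepsilon>0$ there is a gauge $\delta$ with $d_H(\Phi,\sum_{i=1}^p\Gamma(t_i)|I_i|)<\varepsilon$ for every $\delta$-fine Perron partition (resp. $\delta$-fine partition) of $[0,1]$. For functions $f:[0,1]\to X$ the same definitions are used with $f$ identified with $t\mapsto\{f(t)\}$ and the integral a vector of $X$. Pettis integrability of $X$-valued functions is with respect to Lebesgue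 measure on $[0,1]$. *)

theory Defs
  imports "HOL-Analysis.Analysis" "HOL-Library.Set_Algebras"
begin

definition weak_topology :: "'a::real_normed_vector topology" where
  "weak_topology =
     topology_generated_by {blinfun_apply x' -` U | (x' :: 'a \<Rightarrow>\<^sub>L real) U. open U}"

definition cwk :: "'a::real_normed_vector set set" where
  "cwk = {K. K \<noteq> {} \<and> convex K \<and> compactin weak_topology K}"

(* Extended-valued, because the Henstock or McShane integral of a multifunction is not
   assumed to be bounded; it is the Hausdorff distance for non-empty arguments only. *)
definition hausdorff_dist :: "'a::metric_space set \<Rightarrow> 'a set \<Rightarrow> ennreal" where
  "hausdorff_dist A B =
     max (SUP a\<in>A. ennreal (infdist a B)) (SUP b\<in>B. ennreal (infdist b A))"

(* As for tagged_division_of, the pairs are (tag, interval) and degenerate intervals {a..a}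
   are allowed; in a Riemann sum of a non-empty valued multifunction the latter contribute {0}. *)
definition tagged_partition :: "(real \<times> real set) set \<Rightarrow> bool" where
  "tagged_partition p \<longleftrightarrow>
     finite p \<and>
     (\<forall>(t, I)\<in>p. t \<in> {0..1} \<and> (\<exists>a b. a \<le> b \<and> I = {a..b})) \<and>
     (\<forall>(t, I)\<in>p. \<forall>(s, J)\<in>p. (t, I) \<noteq> (s, J) \<longrightarrow> interior I \<inter> interior J = {}) \<and>
     (\<Union>(t, I)\<in>p. I) = {0..1}"

definition perron_partition :: "(real \<times> real set) set \<Rightarrow> bool" where
  "perron_partition p \<longleftrightarrow> tagged_partition p \<and> (\<forall>(t, I)\<in>p. t \<in> I)"

lemma perron_partition_iff_tagged_division:
  "perron_partition p \<longleftrightarrow> p tagged_division_of {0..1}"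
proof
  assume "perron_partition p"
  then have fin: "finite p"
    and iv: "\<And>t I. (t, I) \<in> p \<Longrightarrow> t \<in> I \<and> (\<exists>a b. I = {a..b})"
    and dis: "\<And>t I s J. (t, I) \<in> p \<Longrightarrow> (s, J) \<in> p \<Longrightarrow> (t, I) \<noteq> (s, J) \<Longrightarrow>
                interior I \<inter> interior J = {}"
    and un: "(\<Union>(t, I)\<in>p. I) = {0..1}"
    unfolding perron_partition_def tagged_partition_def by (simp, fast, fast, simp)
  show "p tagged_division_of {0..1}"
  proof (rule tagged_division_ofI)
    show "finite p" by (rule fin)
    show "t \<in> I" if "(t, I) \<in> p" for t I using iv[OF that] by blast
    show "I \<subseteq> {0..1}" if "(t, I) \<in> p" for t I using that un by blast
    show "\<exists>a b. I = cbox a b" if "(t, I) \<in> p" for t I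
      using iv[OF that] by (simp add: cbox_interval)
    show "interior I \<inter> interior J = {}"
      if "(t, I) \<in> p" "(s, J) \<in> p" "(t, I) \<noteq> (s, J)" for t I s J
      using dis[OF that] .
    have "\<Union>{I. \<exists>t. (t, I) \<in> p} = (\<Union>(t, I)\<in>p. I)" by auto
    then show "\<Union>{I. \<exists>t. (t, I) \<in> p} = {0..1}" using un by simp
  qed
next
  assume p: "p tagged_division_of {0..1}"
  have 1: "t \<in> {0..1} \<and> (\<exists>a b. a \<le> b \<and> I = {a..b})" "t \<in> I" if "(t, I) \<in> p" for t I
  proof -
    have I: "t \<in> I" "I \<subseteq> {0..1}"
      using tagged_division_ofD(2,3)[OF p that] .
    from tagged_division_ofD(4)[OF p that] obtain a b where ab: "I = {a..b}"
      unfolding interval_cbox by blast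
    have "t \<in> {0..1}" using I by (rule rev_subsetD)
    moreover have "a \<le> b" using I(1) unfolding ab by simp
    ultimately show "t \<in> {0..1} \<and> (\<exists>a b. a \<le> b \<and> I = {a..b})"
      using ab by blast
    show "t \<in> I" by (rule I(1))
  qed
  have 2: "(\<Union>(t, I)\<in>p. I) = {0..1}"
  proof -
    have "(\<Union>(t, I)\<in>p. I) = \<Union>{I. \<exists>t. (t, I) \<in> p}" by auto
    then show ?thesis using tagged_division_ofD(6)[OF p] by simp
  qed
  have 3: "interior I \<inter> interior J = {}"
    if "(t, I) \<in> p" "(s, J) \<in> p" "(t, I) \<noteq> (s, J)" for t I s J
    using tagged_division_ofD(5)[OF p that] .
  show "perron_partition p"
    unfolding perron_partition_def tagged_partition_def
  proof (intro conjI ballI)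
    show "finite p" by (rule tagged_division_ofD(1)[OF p])
    show "(\<Union>(t, I)\<in>p. I) = {0..1}" by (rule 2)
    show "case x of (t, I) \<Rightarrow> t \<in> {0..1} \<and> (\<exists>a b. a \<le> b \<and> I = {a..b})" if "x \<in> p" for x
      using 1(1) that by (cases x) simp
    show "case x of (t, I) \<Rightarrow> t \<in> I" if "x \<in> p" for x
      using 1(2) that by (cases x) simp
    show "case x of (t, I) \<Rightarrow> \<forall>(s, J)\<in>p. (t, I) \<noteq> (s, J) \<longrightarrow> interior I \<inter> interior J = {}"
      if "x \<in> p" for x
    proof -
      have "\<forall>(s, J)\<in>p. (t, I) \<noteq> (s, J) \<longrightarrow> interior I \<inter> interior J = {}" if "(t, I) \<in> p" for t I
        using 3[OF that] by (intro ballI) (simp only: split_paired_all prod.case, blast)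
      then show ?thesis using that by (cases x) simp
    qed
  qed
qed

definition delta_fine :: "(real \<Rightarrow> real) \<Rightarrow> (real \<times> real set) set \<Rightarrow> bool" where
  "delta_fine \<delta> p \<longleftrightarrow> (\<forall>(t, I)\<in>p. I \<subseteq> {t - \<delta> t<..<t + \<delta> t})"

definition riemann_sum ::
  "(real \<Rightarrow> 'a::real_normed_vector set) \<Rightarrow> (real \<times> real set) set \<Rightarrow> 'a set" where
  "riemann_sum \<Gamma> p = (\<Sum>(t, I)\<in>p. (\<lambda>x. measure lborel I *\<^sub>R x) ` \<Gamma> t)"

definition has_henstock_integral_multi ::
  "(real \<Rightarrow> 'a::real_normed_vector set) \<Rightarrow> 'a set \<Rightarrow> bool" where
  "has_henstock_integral_multi \<Gamma> \<Phi> \<longleftrightarrow>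
     \<Phi> \<noteq> {} \<and> closed \<Phi> \<and> convex \<Phi> \<and>
     (\<forall>\<epsilon>>0. \<exists>\<delta>. (\<forall>t\<in>{0..1}. \<delta> t > 0) \<and>
        (\<forall>p. perron_partition p \<and> delta_fine \<delta> p \<longrightarrow>
           hausdorff_dist \<Phi> (riemann_sum \<Gamma> p) < ennreal \<epsilon>))"

definition has_mcshane_integral_multi ::
  "(real \<Rightarrow> 'a::real_normed_vector set) \<Rightarrow> 'a set \<Rightarrow> bool" where
  "has_mcshane_integral_multi \<Gamma> \<Phi> \<longleftrightarrow>
     \<Phi> \<noteq> {} \<and> closed \<Phi> \<and> convex \<Phi> \<and>
     (\<forall>\<epsilon>>0. \<exists>\<delta>. (\<forall>t\<in>{0..1}. \<delta> t > 0) \<and>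
        (\<forall>p. tagged_partition p \<and> delta_fine \<delta> p \<longrightarrow>
           hausdorff_dist \<Phi> (riemann_sum \<Gamma> p) < ennreal \<epsilon>))"

definition henstock_integrable_multi :: "(real \<Rightarrow> 'a::real_normed_vector set) \<Rightarrow> bool" where
  "henstock_integrable_multi \<Gamma> \<longleftrightarrow> (\<exists>\<Phi>. has_henstock_integral_multi \<Gamma> \<Phi>)"

definition mcshane_integrable_multi :: "(real \<Rightarrow> 'a::real_normed_vector set) \<Rightarrow> bool" where
  "mcshane_integrable_multi \<Gamma> \<longleftrightarrow> (\<exists>\<Phi>. has_mcshane_integral_multi \<Gamma> \<Phi>)"

definition henstock_integrable :: "(real \<Rightarrow> 'a::real_normed_vector) \<Rightarrow> bool" where
  "henstock_integrable f \<longleftrightarrow> (\<exists>v. has_henstock_integral_multi (\<lambda>t. {f t}) {v})"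

definition mcshane_integrable :: "(real \<Rightarrow> 'a::real_normed_vector) \<Rightarrow> bool" where
  "mcshane_integrable f \<longleftrightarrow> (\<exists>v. has_mcshane_integral_multi (\<lambda>t. {f t}) {v})"

definition scalarly_measurable :: "(real \<Rightarrow> 'a::real_normed_vector) \<Rightarrow> bool" where
  "scalarly_measurable f \<longleftrightarrow>
     (\<forall>x' :: 'a \<Rightarrow>\<^sub>L real. (\<lambda>t. blinfun_apply x' (f t)) \<in> borel_measurable (lebesgue_on {0..1}))"

definition pettis_integrable :: "(real \<Rightarrow> 'a::real_normed_vector) \<Rightarrow> bool" where
  "pettis_integrable f \<longleftrightarrow>
     (\<forall>x' :: 'a \<Rightarrow>\<^sub>L real. integrable (lebesgue_on {0..1}) (\<lambda>t. blinfun_apply x' (f t))) \<and>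
     (\<forall>E\<in>sets (lebesgue_on {0..1}). \<exists>v. \<forall>x' :: 'a \<Rightarrow>\<^sub>L real.
        blinfun_apply x' v = (LINT t:E|lebesgue_on {0..1}. blinfun_apply x' (f t)))"

definition selection_of :: "(real \<Rightarrow> 'a) \<Rightarrow> (real \<Rightarrow> 'a set) \<Rightarrow> bool" where
  "selection_of f \<Gamma> \<longleftrightarrow> (\<forall>t\<in>{0..1}. f t \<in> \<Gamma> t)"

lemma riemann_sum_singleton:
  "finite p \<Longrightarrow> riemann_sum (\<lambda>t. {f t}) p = {\<Sum>(t, I)\<in>p. measure lborel I *\<^sub>R f t}"
  unfolding riemann_sum_def
  by (induction p rule: finite_induct) (auto simp: set_plus_def)

lemma hausdorff_dist_singleton: "hausdorff_dist {x} {y} = ennreal (dist x y)"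
  by (simp add: hausdorff_dist_def dist_commute)

lemma mcshane_integrable_iff:
  "mcshane_integrable f \<longleftrightarrow>
     (\<exists>v. \<forall>\<epsilon>>0. \<exists>\<delta>. (\<forall>t\<in>{0..1}. \<delta> t > 0) \<and>
        (\<forall>p. tagged_partition p \<and> delta_fine \<delta> p \<longrightarrow>
           norm (v - (\<Sum>(t, I)\<in>p. measure lborel I *\<^sub>R f t)) < \<epsilon>))"
proof -
  have "finite p" if "tagged_partition p" for p
    using that by (simp add: tagged_partition_def)
  then show ?thesis
    unfolding mcshane_integrable_def has_mcshane_integral_multi_def
    by (simp add: riemann_sum_singleton hausdorff_dist_singleton dist_norm ennreal_less_iff
        cong: conj_cong imp_cong)
qed

lemma henstock_integrable_iff_integrable_on:
  fixes f :: "real \<Rightarrow> 'a::real_normed_vector"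
  shows "henstock_integrable f \<longleftrightarrow> f integrable_on {0..1}"
proof -
  define S where "S = (\<lambda>p :: (real \<times> real set) set. \<Sum>(t, I)\<in>p. measure lborel I *\<^sub>R f t)"
  have fin: "finite p" if "perron_partition p" for p
    using that by (simp add: perron_partition_def tagged_partition_def)
  have tag: "t \<in> {0..1}" if "perron_partition p" "(t, I) \<in> p" for p t I
    using that by (auto simp: perron_partition_def tagged_partition_def)
  have "has_henstock_integral_multi (\<lambda>t. {f t}) {v} \<longleftrightarrow> (f has_integral v) (cbox 0 1)" for v
  proof -
    have "has_henstock_integral_multi (\<lambda>t. {f t}) {v} \<longleftrightarrow>
        (\<forall>\<epsilon>>0. \<exists>\<delta>. (\<forall>t\<in>{0..1}. \<delta> t > 0) \<and>
          (\<forall>p. perron_partition p \<and> delta_fine \<delta> p \<longrightarrow> norm (S p - v) < \<epsilon>))"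
      unfolding has_henstock_integral_multi_def
      by (simp add: riemann_sum_singleton fin hausdorff_dist_singleton dist_norm
          ennreal_less_iff S_def norm_minus_commute cong: conj_cong imp_cong)
    also have "\<dots> \<longleftrightarrow> (\<forall>\<epsilon>>0. \<exists>\<gamma>. gauge \<gamma> \<and>
          (\<forall>p. perron_partition p \<and> \<gamma> fine p \<longrightarrow> norm (S p - v) < \<epsilon>))"
    proof -
      have "(\<exists>\<delta>. (\<forall>t\<in>{0..1}. \<delta> t > 0) \<and> (\<forall>p. perron_partition p \<and> delta_fine \<delta> p \<longrightarrow> P p)) \<longleftrightarrow>
            (\<exists>\<gamma>. gauge \<gamma> \<and> (\<forall>p. perron_partition p \<and> \<gamma> fine p \<longrightarrow> P p))" (is "?L \<longleftrightarrow> ?R") for P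
      proof
        assume ?L
        then obtain \<delta> where d: "\<forall>t\<in>{0..1}. \<delta> t > (0::real)"
          "\<And>p. perron_partition p \<Longrightarrow> delta_fine \<delta> p \<Longrightarrow> P p" by blast
        define \<gamma> where "\<gamma> = (\<lambda>t. if t \<in> {0..1} then {t - \<delta> t<..<t + \<delta> t} else UNIV)"
        have "gauge \<gamma>" using d(1) by (auto simp: gauge_def \<gamma>_def)
        moreover have "delta_fine \<delta> p" if "perron_partition p" "\<gamma> fine p" for p
          unfolding delta_fine_def
        proof clarify
          fix t I x assume tI: "(t, I) \<in> p" "x \<in> I"
          with that(2) have "x \<in> \<gamma> t" by (auto simp: fine_def)
          then show "x \<in> {t - \<delta> t<..<t + \<delta> t}"
            using tag[OF that(1) tI(1)] by (simp add: \<gamma>_def)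
        qed
        ultimately show ?R using d(2) by (intro exI[of _ \<gamma>]) simp
      next
        assume ?R
        then obtain \<gamma> where g: "gauge \<gamma>"
          "\<And>p. perron_partition p \<Longrightarrow> \<gamma> fine p \<Longrightarrow> P p" by blast
        have "\<forall>t. \<exists>e>0. ball t e \<subseteq> \<gamma> t"
          using g(1) unfolding gauge_def by (meson open_contains_ball)
        then obtain \<delta> where d: "\<And>t. \<delta> t > 0" "\<And>t. ball t (\<delta> t) \<subseteq> \<gamma> t" by metis
        have "\<gamma> fine p" if "delta_fine \<delta> p" for p
          using that d(2) unfolding delta_fine_def fine_def ball_eq_greaterThanLessThan by fast
        then show ?L using d(1) g(2) by (intro exI[of _ \<delta>]) simp
      qed
      then show ?thesis by simp
    qed
    also have "\<dots> \<longleftrightarrow> (f has_integral v) (cbox 0 1)"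
      unfolding has_integral S_def perron_partition_iff_tagged_division
      by (simp only: interval_cbox)
    finally show ?thesis .
  qed
  then show ?thesis
    by (simp add: henstock_integrable_def integrable_on_def cbox_interval)
qed

end

theory Submission
  imports Defs
begin

text \<open>
The two kinds of integral are treated at once: a Riemann-type integral is taken over a class \<open>P\<close> of
partitions lying between the Perron partitions and all tagged partitions. Let \<open>\<Phi>\<close> be the integral of
\<open>\<Gamma>\<close>.

The set \<open>\<Phi>\<close> is a limit of Riemann sums of weakly compact sets, and it is again weakly compact, in the
strong form that every linear functional on the dual dominated by the support function of \<open>\<Phi>\<close> is the
evaluation at a point of \<open>\<Phi>\<close> (\<open>bidual_closed\<close>). A non-empty weakly compact set has a strongly exposed point:
for a suitable functional \<open>x'\<close>, near-maximality of \<open>x'\<close> forces a point to be close to one point \<open>x0\<close>,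
and this is stable under small perturbations of the set (\<open>stably_exposed_point_exists\<close>). Choose
\<open>f t \<in> \<Gamma> t\<close> maximising \<open>x'\<close> over \<open>\<Gamma> t\<close>. The Riemann sum of \<open>f\<close> then maximises \<open>x'\<close> over the Riemann
sum of \<open>\<Gamma>\<close>, which is close to \<open>\<Phi>\<close>, so the Riemann sums of \<open>f\<close> converge in norm to \<open>x0\<close>. Hence
\<open>\<Gamma>\<close> has an integrable selection \<open>f\<close> (\<open>integrable_selection_exists\<close>).

Let \<open>g\<close> be a scalarly measurable selection. The functions \<open>t \<mapsto> support x' (\<Gamma> t) - x' (f t)\<close> are
nonnegative and Henstock-Kurzweil integrable, hence Lebesgue integrable, and they dominate
\<open>x' (g t - f t)\<close>. Over any measurable \<open>E\<close> the integral of \<open>x' (g - f)\<close> is therefore at most the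
integral over \<open>[0,1]\<close> of the dominating function, which is \<open>support x' \<Phi> - x' x0\<close>; the
representation property of \<open>\<Phi>\<close> turns this bound into a vector integral over \<open>E\<close>. So \<open>g - f\<close> is Pettis
integrable (\<open>difference_of_selections_pettis\<close>). By the assumption on the space it is McShane
integrable, in particular Henstock integrable, and \<open>g = f + (g - f)\<close>.

The functional-analytic tools are built on one form of the Hahn-Banach theorem (\<open>sandwich_cone\<close>). The
strongly exposed point comes from three facts: weakly compact sets have relatively weakly open pieces of
small diameter (\<open>weakly_compact_fragment\<close>); on some open set of functionals all maxima are therefore
attained in a small ball (\<open>maxima_localise\<close>); and the Baire category theorem in the dual lets the
radius of that ball tend to zero (\<open>generic_functional\<close>).
\<close>

section \<open>Sublinear functionals and separation\<close>


definition sublinear :: "('v::real_vector \<Rightarrow> real) \<Rightarrow> bool" where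
  "sublinear p \<longleftrightarrow> (\<forall>x y. p (x + y) \<le> p x + p y) \<and> (\<forall>t\<ge>0. \<forall>x. p (t *\<^sub>R x) = t * p x)"

lemma sublinearI:
  assumes "\<And>x y. p (x + y) \<le> p x + p y" and "\<And>t x. t > 0 \<Longrightarrow> p (t *\<^sub>R x) \<le> t * p x" and "p 0 = 0"
  shows "sublinear p"
proof -
  have "t * p x \<le> p (t *\<^sub>R x)" if "t > 0" for t x
  proof -
    have "p x \<le> inverse t * p (t *\<^sub>R x)"
      using assms(2)[of "inverse t" "t *\<^sub>R x"] that by simp
    then show ?thesis using that by (simp add: field_simps)
  qed
  then have "p (t *\<^sub>R x) = t * p x" if "t \<ge> 0" for t x
    using assms(2)[of t x] assms(3) that by (cases "t = 0") (auto intro: antisym)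
  with assms(1) show ?thesis unfolding sublinear_def by blast
qed

lemma
  assumes "sublinear p"
  shows sublinear_add: "p (x + y) \<le> p x + p y"
    and sublinear_scale: "t \<ge> 0 \<Longrightarrow> p (t *\<^sub>R x) = t * p x"
    and sublinear_zero: "p 0 = 0"
    and sublinear_minus: "- p (- x) \<le> p x"
proof -
  show *: "p (x + y) \<le> p x + p y" for x y using assms by (auto simp: sublinear_def)
  show "t \<ge> 0 \<Longrightarrow> p (t *\<^sub>R x) = t * p x" for t x using assms by (auto simp: sublinear_def)
  from this[of 0 0] show "p 0 = 0" by simp
  with *[of x "- x"] show "- p (- x) \<le> p x" by simp
qed

text \<open>
The infimal convolution of \<open>p\<close> with a convex cone \<open>S\<close> of lower constraints. A pair \<open>(y, c)\<close> in \<open>S\<close>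
stands for the demand \<open>c \<le> L y\<close> on a linear functional \<open>L\<close>; passing from \<open>p\<close> to \<open>q\<close> turns this demand into
the upper bound \<open>L (- y) \<le> - c\<close>, which every functional below \<open>q\<close> meets. The infimum is finite because
\<open>c \<le> p y\<close> keeps it above \<open>- p (- x)\<close>.
\<close>

lemma sublinear_inf_cone:
  fixes p :: "'v::real_vector \<Rightarrow> real"
  assumes p: "sublinear p"
    and S0: "(0, 0) \<in> S"
    and S_add: "\<And>y c y' c'. (y, c) \<in> S \<Longrightarrow> (y', c') \<in> S \<Longrightarrow> (y + y', c + c') \<in> S"
    and S_scale: "\<And>t y c. t > 0 \<Longrightarrow> (y, c) \<in> S \<Longrightarrow> (t *\<^sub>R y, t * c) \<in> S"
    and below: "\<And>y c. (y, c) \<in> S \<Longrightarrow> c \<le> p y"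
  obtains q where "sublinear q" "\<And>x. q x \<le> p x" "\<And>y c. (y, c) \<in> S \<Longrightarrow> q (- y) \<le> - c"
proof -
  define q where "q x = (INF (y, c)\<in>S. p (x + y) - c)" for x
  have lb: "- p (- x) \<le> p (x + y) - c" if "(y, c) \<in> S" for x y c
    using sublinear_add[OF p, of "x + y" "- x"] below[OF that] by simp
  have bdd: "bdd_below ((\<lambda>(y, c). p (x + y) - c) ` S)" for x
    using lb by (intro bdd_belowI[of _ "- p (- x)"]) auto
  have q_le: "q x \<le> p (x + y) - c" if "(y, c) \<in> S" for x y c
    unfolding q_def using cINF_lower[OF bdd that] by simp
  have q_ge: "b \<le> q x" if "\<And>y c. (y, c) \<in> S \<Longrightarrow> b \<le> p (x + y) - c" for b x
    unfolding q_def using S0 that by (intro cINF_greatest) auto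
  show thesis
  proof
    show "q x \<le> p x" for x using q_le[OF S0, of x] by simp
    show "q (- y) \<le> - c" if "(y, c) \<in> S" for y c
      using q_le[OF that, of "- y"] sublinear_zero[OF p] by simp
    show "sublinear q"
    proof (rule sublinearI)
      show "q 0 = 0"
        using q_le[OF S0, of 0] q_ge[of 0 0] below sublinear_zero[OF p] by (fastforce intro: antisym)
      show "q (x + y) \<le> q x + q y" for x y
      proof -
        have "q (x + y) - (p (x + z) - c) \<le> q y" if zc: "(z, c) \<in> S" for z c
        proof (rule q_ge)
          fix z' c' assume zc': "(z', c') \<in> S"
          have "q (x + y) \<le> p ((x + z) + (y + z')) - (c + c')"
            using q_le[OF S_add[OF zc zc'], of "x + y"] by (simp add: algebra_simps)
          also have "\<dots> \<le> p (x + z) + p (y + z') - (c + c')"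
            using sublinear_add[OF p] by simp
          finally show "q (x + y) - (p (x + z) - c) \<le> p (y + z') - c'" by simp
        qed
        then have "q (x + y) - q y \<le> q x" by (intro q_ge) (simp add: algebra_simps)
        then show ?thesis by simp
      qed
      show "q (t *\<^sub>R x) \<le> t * q x" if t: "t > 0" for t x
      proof -
        have "q (t *\<^sub>R x) / t \<le> q x"
        proof (rule q_ge)
          fix y c assume "(y, c) \<in> S"
          from q_le[OF S_scale[OF t this], of "t *\<^sub>R x"]
          have "q (t *\<^sub>R x) \<le> p (t *\<^sub>R (x + y)) - t * c" by (simp add: algebra_simps)
          also have "\<dots> = t * (p (x + y) - c)"
            using sublinear_scale[OF p, of t "x + y"] t by (simp add: right_diff_distrib)
          finally show "q (t *\<^sub>R x) / t \<le> p (x + y) - c" using t by (simp add: field_simps)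
        qed
        then show ?thesis using t by (simp add: field_simps)
      qed
    qed
  qed
qed

text \<open>
Zorn's lemma applies to the pointwise order because a sublinear functional below \<open>p\<close> is bounded below by
\<open>- p (- x)\<close>, so that chains have finite pointwise infima.
\<close>

lemma minimal_sublinear:
  fixes p :: "'v::real_vector \<Rightarrow> real"
  assumes p: "sublinear p"
  obtains m where "sublinear m" "\<And>x. m x \<le> p x"
    "\<And>r. sublinear r \<Longrightarrow> (\<And>x. r x \<le> m x) \<Longrightarrow> r = m"
proof -
  define A where "A = {r. sublinear r \<and> r \<le> p}"
  have "\<exists>m\<in>A. \<forall>a\<in>A. a \<le> m \<longrightarrow> a = m"
  proof (rule predicate_Zorn)
    show "partial_order_on A (relation_of (\<lambda>a b. b \<le> a) A)"
      by (rule partial_order_on_relation_ofI) auto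
    fix C assume "C \<in> Chains (relation_of (\<lambda>a b. b \<le> a) A)"
    then have CA: "C \<subseteq> A" and chain: "\<And>a b. a \<in> C \<Longrightarrow> b \<in> C \<Longrightarrow> a \<le> b \<or> b \<le> a"
      by (auto simp: Chains_def relation_of_def)
    show "\<exists>u\<in>A. \<forall>a\<in>C. u \<le> a"
    proof (cases "C = {}")
      case True
      then show ?thesis using p by (auto simp: A_def)
    next
      case False
      define u where "u x = (INF r\<in>C. r x)" for x
      have lb: "- p (- x) \<le> r x" if "r \<in> C" for r x
      proof -
        have "sublinear r" "r (- x) \<le> p (- x)" using CA that by (auto simp: A_def le_fun_def)
        then show ?thesis using sublinear_minus[of r x] by simp
      qed
      have bdd: "bdd_below ((\<lambda>r. r x) ` C)" for x
        using lb by (intro bdd_belowI[of _ "- p (- x)"]) auto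
      have u_le: "u x \<le> r x" if "r \<in> C" for r x
        unfolding u_def using cINF_lower[OF bdd that] by simp
      have u_ge: "b \<le> u x" if "\<And>r. r \<in> C \<Longrightarrow> b \<le> r x" for b x
        unfolding u_def using False that by (intro cINF_greatest) auto
      have subl: "sublinear r" if "r \<in> C" for r using CA that by (auto simp: A_def)
      have "sublinear u"
      proof (rule sublinearI)
        show "u 0 = 0"
          unfolding u_def using False by (simp add: sublinear_zero[OF subl] cong: INF_cong_simp)
        show "u (x + y) \<le> u x + u y" for x y
        proof -
          have "u (x + y) - r x \<le> u y" if r: "r \<in> C" for r
          proof (rule u_ge)
            fix s assume s: "s \<in> C"
            \<comment> \<open>The smaller of the two members of the chain serves both summands.\<close>
            from chain[OF r s] show "u (x + y) - r x \<le> s y"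
            proof
              assume "r \<le> s"
              then show ?thesis
                using u_le[OF r, of "x + y"] sublinear_add[OF subl[OF r], of x y]
                by (force simp: le_fun_def dest: spec[of _ y])
            next
              assume "s \<le> r"
              then show ?thesis
                using u_le[OF s, of "x + y"] sublinear_add[OF subl[OF s], of x y]
                by (force simp: le_fun_def dest: spec[of _ x])
            qed
          qed
          then have "u (x + y) - u y \<le> u x" by (intro u_ge) (simp add: algebra_simps)
          then show ?thesis by simp
        qed
        show "u (t *\<^sub>R x) \<le> t * u x" if t: "t > 0" for t x
        proof -
          have "u (t *\<^sub>R x) / t \<le> u x"
          proof (rule u_ge)
            fix r assume r: "r \<in> C"
            show "u (t *\<^sub>R x) / t \<le> r x"
              using u_le[OF r, of "t *\<^sub>R x"] sublinear_scale[OF subl[OF r], of t x] t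
              by (simp add: field_simps)
          qed
          then show ?thesis using t by (simp add: field_simps)
        qed
      qed
      moreover have "u \<le> p"
      proof (rule le_funI)
        fix x
        from False obtain r where r: "r \<in> C" by auto
        then have "r x \<le> p x" using CA by (auto simp: A_def le_fun_def)
        then show "u x \<le> p x" using u_le[OF r, of x] by simp
      qed
      ultimately show ?thesis using u_le by (auto simp: A_def le_fun_def)
    qed
  qed
  then obtain m where m: "m \<in> A" "\<And>a. a \<in> A \<Longrightarrow> a \<le> m \<Longrightarrow> a = m" by blast
  have mp: "sublinear m" "m \<le> p" using m(1) by (auto simp: A_def)
  show thesis
  proof
    show "sublinear m" by (rule mp(1))
    show "m x \<le> p x" for x using mp(2) by (simp add: le_fun_def)
    show "r = m" if "sublinear r" "\<And>x. r x \<le> m x" for r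
      using that mp(2) by (intro m(2)) (auto simp: A_def le_fun_def intro: order_trans)
  qed
qed

text \<open>
Imposing the constraint \<open>m a \<le> L a\<close> on a minimal \<open>m\<close> by \<open>sublinear_inf_cone\<close> cannot change \<open>m\<close>; hence
\<open>m (- a) \<le> - m a\<close>, and a sublinear functional that is odd is linear.
\<close>

lemma minimal_sublinear_imp_linear:
  fixes m :: "'v::real_vector \<Rightarrow> real"
  assumes m: "sublinear m" and min: "\<And>r. sublinear r \<Longrightarrow> (\<And>x. r x \<le> m x) \<Longrightarrow> r = m"
  shows "linear m"
proof -
  have minus: "m (- a) = - m a" for a
  proof -
    obtain q where q: "sublinear q" "\<And>x. q x \<le> m x"
      "\<And>y c. (y, c) \<in> {(t *\<^sub>R a, t * m a) |t. t \<ge> 0} \<Longrightarrow> q (- y) \<le> - c"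
    proof (rule sublinear_inf_cone[OF m, of "{(t *\<^sub>R a, t * m a) |t. t \<ge> 0}"])
      show "(0, 0) \<in> {(t *\<^sub>R a, t * m a) |t. t \<ge> 0}" by (auto intro: exI[of _ 0])
      show "(y + y', c + c') \<in> {(t *\<^sub>R a, t * m a) |t. t \<ge> 0}"
        if "(y, c) \<in> {(t *\<^sub>R a, t * m a) |t. t \<ge> 0}" "(y', c') \<in> {(t *\<^sub>R a, t * m a) |t. t \<ge> 0}"
        for y c y' c'
      proof -
        from that obtain t t' where "t \<ge> 0" "t' \<ge> 0" "y = t *\<^sub>R a" "c = t * m a"
          "y' = t' *\<^sub>R a" "c' = t' * m a" by blast
        then show ?thesis by (auto intro!: exI[of _ "t + t'"] simp: algebra_simps)
      qed
      show "(t *\<^sub>R y, t * c) \<in> {(t *\<^sub>R a, t * m a) |t. t \<ge> 0}"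
        if "t > 0" "(y, c) \<in> {(t *\<^sub>R a, t * m a) |t. t \<ge> 0}" for t y c
      proof -
        from that obtain s where "s \<ge> 0" "y = s *\<^sub>R a" "c = s * m a" by blast
        with \<open>t > 0\<close> show ?thesis by (auto intro!: exI[of _ "t * s"])
      qed
    qed (auto simp: sublinear_scale[OF m])
    have "(a, m a) \<in> {(t *\<^sub>R a, t * m a) |t. t \<ge> 0}" by (auto intro: exI[of _ 1])
    with q(3) have "q (- a) \<le> - m a" by blast
    moreover have "q = m" using q(1,2) by (rule min)
    ultimately show ?thesis using sublinear_minus[OF m, of a] by simp
  qed
  show ?thesis
  proof (rule linearI)
    show "m (x + y) = m x + m y" for x y
      using sublinear_add[OF m, of x y] sublinear_add[OF m, of "- x" "- y"] minus[of "x + y"]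
      by (simp add: minus)
    show "m (r *\<^sub>R x) = r *\<^sub>R m x" for r x
      using sublinear_scale[OF m, of r x] sublinear_scale[OF m, of "- r" x] minus[of "r *\<^sub>R x"]
      by (cases "r \<ge> 0") auto
  qed
qed

text \<open>
The Hahn-Banach theorem in the form used throughout: a linear functional fits between a sublinear
functional and a convex cone of lower constraints. Separation of a point from a convex set and the
splitting of a functional dominated by a sum are both obtained by choosing the cone.
\<close>

theorem sandwich_cone:
  fixes p :: "'v::real_vector \<Rightarrow> real"
  assumes p: "sublinear p"
    and S0: "(0, 0) \<in> S"
    and S_add: "\<And>y c y' c'. (y, c) \<in> S \<Longrightarrow> (y', c') \<in> S \<Longrightarrow> (y + y', c + c') \<in> S"
    and S_scale: "\<And>t y c. t > 0 \<Longrightarrow> (y, c) \<in> S \<Longrightarrow> (t *\<^sub>R y, t * c) \<in> S"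
    and below: "\<And>y c. (y, c) \<in> S \<Longrightarrow> c \<le> p y"
  obtains L where "linear L" "\<And>x. L x \<le> p x" "\<And>y c. (y, c) \<in> S \<Longrightarrow> c \<le> L y"
proof -
  obtain q where q: "sublinear q" "\<And>x. q x \<le> p x" "\<And>y c. (y, c) \<in> S \<Longrightarrow> q (- y) \<le> - c"
    using sublinear_inf_cone[OF p S0 S_add S_scale below] by blast
  obtain m where m: "sublinear m" "\<And>x. m x \<le> q x"
    "\<And>r. sublinear r \<Longrightarrow> (\<And>x. r x \<le> m x) \<Longrightarrow> r = m"
    using minimal_sublinear[OF q(1)] by blast
  have lin: "linear m" using m(1,3) by (rule minimal_sublinear_imp_linear)
  show thesis
  proof
    show "linear m" by (rule lin)
    show "m x \<le> p x" for x using m(2)[of x] q(2)[of x] by simp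
    show "c \<le> m y" if "(y, c) \<in> S" for y c
      using q(3)[OF that] m(2)[of "- y"] linear_neg[OF lin, of y] by simp
  qed
qed

text \<open>
The constraints are \<open>d \<le> L (x - c)\<close> for \<open>c\<close> in \<open>C\<close>, together with their positive multiples. Convexity of
\<open>C\<close> is what makes these pairs closed under addition.
\<close>

lemma separation_distance:
  fixes x :: "'a::real_normed_vector"
  assumes C: "convex C" and d: "\<And>c. c \<in> C \<Longrightarrow> d \<le> norm (x - c)"
  obtains x' :: "'a \<Rightarrow>\<^sub>L real" where "norm x' \<le> 1" "\<And>c. c \<in> C \<Longrightarrow> x' c + d \<le> x' x"
proof -
  define S where "S = insert (0, 0) {(t *\<^sub>R (x - c), t * d) |t c. t > 0 \<and> c \<in> C}"
  have "sublinear (norm :: 'a \<Rightarrow> real)"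
    by (auto simp: sublinear_def norm_triangle_ineq)
  then obtain L :: "'a \<Rightarrow> real" where L: "linear L" "\<And>y. L y \<le> norm y" "\<And>y c. (y, c) \<in> S \<Longrightarrow> c \<le> L y"
  proof (rule sandwich_cone[of norm S])
    show "(0, 0) \<in> S" by (simp add: S_def)
    show "(t *\<^sub>R y, t * c) \<in> S" if t: "t > 0" and yc: "(y, c) \<in> S" for t y c
    proof (cases "(y, c) = (0, 0)")
      case False
      with yc obtain s e where "s > 0" "e \<in> C" "y = s *\<^sub>R (x - e)" "c = s * d" by (auto simp: S_def)
      then show ?thesis using t by (auto simp: S_def intro!: exI[of _ "t * s"] exI[of _ e])
    qed (auto simp: S_def)
    show "c \<le> norm y" if "(y, c) \<in> S" for y c
      using that d by (auto simp: S_def)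
    show "(y + y', c + c') \<in> S" if yc: "(y, c) \<in> S" and yc': "(y', c') \<in> S" for y c y' c'
    proof (cases "(y, c) = (0, 0) \<or> (y', c') = (0, 0)")
      case True
      then show ?thesis using that by auto
    next
      case False
      with yc yc' obtain t e t' e' where t: "t > 0" "e \<in> C" "y = t *\<^sub>R (x - e)" "c = t * d"
        "t' > 0" "e' \<in> C" "y' = t' *\<^sub>R (x - e')" "c' = t' * d" by (auto simp: S_def)
      define e'' where "e'' = (t / (t + t')) *\<^sub>R e + (t' / (t + t')) *\<^sub>R e'"
      have "e'' \<in> C" unfolding e''_def
        using t by (intro convexD[OF C]) (auto simp: add_divide_distrib[symmetric])
      moreover have "(t + t') *\<^sub>R e'' = t *\<^sub>R e + t' *\<^sub>R e'"
        using t unfolding e''_def by (simp add: scaleR_add_right)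
      then have "y + y' = (t + t') *\<^sub>R (x - e'')" by (simp add: t algebra_simps)
      moreover have "c + c' = (t + t') * d" by (simp add: t algebra_simps)
      ultimately show ?thesis using t(1,5) unfolding S_def
        by (auto intro!: exI[of _ "t + t'"] exI[of _ e''])
    qed
  qed blast
  have Lb: "norm (L y) \<le> norm y * 1" for y
    using L(2)[of y] L(2)[of "- y"] linear_neg[OF L(1), of y] by (simp add: abs_le_iff)
  have bl: "bounded_linear L"
    using L(1) Lb by (intro bounded_linear_intro[where K = 1]) (simp_all add: linear_add linear_scale)
  show thesis
  proof
    show "norm (Blinfun L) \<le> 1"
      using Lb by (intro norm_blinfun_bound) (auto simp: bounded_linear_Blinfun_apply[OF bl])
    fix c assume "c \<in> C"
    then have "(1 *\<^sub>R (x - c), 1 * d) \<in> S" unfolding S_def using zero_less_one by blast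
    then have "d \<le> L (x - c)" using L(3) by force
    then show "Blinfun L c + d \<le> Blinfun L x"
      using linear_diff[OF L(1), of x c] by (simp add: bounded_linear_Blinfun_apply[OF bl])
  qed
qed

lemma norming_functional:
  fixes x :: "'a::real_normed_vector"
  obtains x' :: "'a \<Rightarrow>\<^sub>L real" where "norm x' \<le> 1" "x' x = norm x"
proof -
  obtain x' :: "'a \<Rightarrow>\<^sub>L real" where x': "norm x' \<le> 1" "\<And>c. c \<in> {0} \<Longrightarrow> x' c + norm x \<le> x' x"
    using separation_distance[of "{0}" "norm x" x] by auto
  have "x' x \<le> norm x' * norm x" using norm_blinfun[of x' x] by simp
  also have "\<dots> \<le> norm x" using x'(1) by (simp add: mult_left_le_one_le)
  finally show thesis using that x' by force
qed

lemma blinfun_le_norm: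
  fixes x' :: "'a::real_normed_vector \<Rightarrow>\<^sub>L real"
  shows "x' x \<le> norm x' * norm x"
  using norm_blinfun[of x' x] by simp


section \<open>Weak compactness and domination by the support function\<close>

text \<open>
The uniform boundedness principle for points acting on the dual, which is complete even when the
space is not.
\<close>

lemma bounded_if_scalarly_bounded:
  fixes A :: "'a::real_normed_vector set"
  assumes A: "\<And>x' :: 'a \<Rightarrow>\<^sub>L real. \<exists>M. \<forall>a\<in>A. \<bar>x' a\<bar> \<le> M"
  shows "\<exists>M\<ge>0. \<forall>a\<in>A. norm a \<le> M"
proof -
  define T :: "nat \<Rightarrow> ('a \<Rightarrow>\<^sub>L real) set" where "T n = {x'. \<forall>a\<in>A. \<bar>blinfun_apply x' a\<bar> \<le> real n}" for n
  have cl: "closed (T n)" for n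
  proof -
    have "T n = (\<Inter>a\<in>A. {x'. \<bar>blinfun_apply x' a\<bar> \<le> real n})" by (auto simp: T_def)
    also have "closed \<dots>" by (intro closed_INT ballI closed_Collect_le continuous_intros)
    finally show ?thesis .
  qed
  have cover: "(\<Union>n. T n) = UNIV"
  proof -
    have "x' \<in> (\<Union>n. T n)" for x' :: "'a \<Rightarrow>\<^sub>L real"
    proof -
      obtain M where M: "\<forall>a\<in>A. \<bar>x' a\<bar> \<le> M" using A by blast
      obtain n where "M \<le> real n" using real_arch_simple by blast
      with M have "x' \<in> T n" by (force simp: T_def)
      then show ?thesis by blast
    qed
    then show ?thesis by blast
  qed
  obtain n where "interior (T n) \<noteq> {}"
  proof (rule ccontr)
    assume "\<not> thesis"
    with that have "interior (T n) = {}" for n by blast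
    then have "euclidean interior_of (\<Union>(range T)) = {}"
      using cl by (intro Baire_category_alt)
        (auto simp: completely_metrizable_space_euclidean)
    then show False using cover by simp
  qed
  then obtain z r where zr: "r > 0" "cball z r \<subseteq> T n"
    by (meson all_not_in_conv mem_interior_cball)
  show ?thesis
  proof (intro exI[of _ "2 * real n / r"] conjI ballI)
    show "0 \<le> 2 * real n / r" using zr(1) by simp
    fix a assume a: "a \<in> A"
    obtain x' :: "'a \<Rightarrow>\<^sub>L real" where x': "norm x' \<le> 1" "x' a = norm a"
      by (rule norming_functional)
    have "norm (r *\<^sub>R x') \<le> r" using zr(1) x'(1) by simp
    then have "z + r *\<^sub>R x' \<in> T n" "z \<in> T n" using zr by (auto simp: dist_norm)
    then have "\<bar>z a + r * norm a\<bar> \<le> real n" "\<bar>z a\<bar> \<le> real n"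
      using a by (auto simp: T_def blinfun.add_left blinfun.scaleR_left x'(2))
    then have "r * norm a \<le> 2 * real n" by linarith
    then show "norm a \<le> 2 * real n / r" using zr(1) by (simp add: field_simps)
  qed
qed

definition evaluation :: "'a::real_normed_vector \<Rightarrow> ('a \<Rightarrow>\<^sub>L real) \<Rightarrow> real" where
  "evaluation x = (\<lambda>x'. x' x)"

text \<open>
Weak compactness is expressed in the product space of all real functions on the dual. The functionals on
the dual that are not evaluations live in the same space, which is how compactness is proved in
\<open>bidual_closed_imp_weakly_compact\<close>.
\<close>

definition weakly_compact :: "'a::real_normed_vector set \<Rightarrow> bool" where
  "weakly_compact A \<longleftrightarrow> compact (evaluation ` A)"

lemma evaluation_apply [simp]: "evaluation x x' = x' x"
  by (simp add: evaluation_def)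

lemma closed_Collect_coordinate_eq:
  fixes x' :: "'i"
  shows "closed {l :: 'i \<Rightarrow> real. l x' = c}"
  by (intro closed_Collect_eq continuous_intros) simp

lemma closed_Collect_coordinate_le:
  fixes x' :: "'i"
  shows "closed {l :: 'i \<Rightarrow> real. l x' \<le> c}" "closed {l :: 'i \<Rightarrow> real. c \<le> l x'}"
  by (intro closed_Collect_le continuous_intros; simp)+

lemma weakly_compact_Int_closed:
  assumes "weakly_compact A" "closed F"
  shows "weakly_compact {x\<in>A. evaluation x \<in> F}"
proof -
  have "evaluation ` {x\<in>A. evaluation x \<in> F} = evaluation ` A \<inter> F" by auto
  then show ?thesis using assms by (simp add: weakly_compact_def compact_Int_closed)
qed

lemma weakly_compact_fip:
  assumes A: "weakly_compact A" and F: "\<And>i. i \<in> I \<Longrightarrow> closed (F i)"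
    and fin: "\<And>J. finite J \<Longrightarrow> J \<subseteq> I \<Longrightarrow> \<exists>x\<in>A. \<forall>i\<in>J. evaluation x \<in> F i"
  shows "\<exists>x\<in>A. \<forall>i\<in>I. evaluation x \<in> F i"
proof -
  have "evaluation ` A \<inter> (\<Inter>i\<in>I. F i) \<noteq> {}"
  proof (rule compact_imp_fip_image)
    show "compact (evaluation ` A)" using A by (simp add: weakly_compact_def)
    show "closed (F i)" if "i \<in> I" for i using F that .
    show "evaluation ` A \<inter> (\<Inter>i\<in>J. F i) \<noteq> {}" if "finite J" "J \<subseteq> I" for J
      using fin[OF that] by blast
  qed
  then show ?thesis by blast
qed

lemma weakly_compact_attains_sup:
  fixes x' :: "'a::real_normed_vector \<Rightarrow>\<^sub>L real"
  assumes "weakly_compact A" "A \<noteq> {}"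
  shows "\<exists>a\<in>A. \<forall>b\<in>A. blinfun_apply x' b \<le> blinfun_apply x' a"
proof -
  have "compact ((\<lambda>l. l x') ` evaluation ` A)"
    using assms(1) unfolding weakly_compact_def
    by (rule compact_continuous_image[OF continuous_on_subset[OF continuous_on_product_coordinates subset_UNIV]])
  moreover have "(\<lambda>l. l x') ` evaluation ` A = blinfun_apply x' ` A" by (auto simp: image_iff)
  ultimately have "\<exists>s\<in>blinfun_apply x' ` A. \<forall>t\<in>blinfun_apply x' ` A. t \<le> s"
    using assms(2) by (intro compact_attains_sup) auto
  then show ?thesis by blast
qed

lemma weakly_compact_imp_bounded:
  fixes A :: "'a::real_normed_vector set"
  assumes "weakly_compact A"
  shows "\<exists>M\<ge>0. \<forall>a\<in>A. norm a \<le> M"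
proof (cases "A = {}")
  case False
  show ?thesis
  proof (rule bounded_if_scalarly_bounded)
    fix x' :: "'a \<Rightarrow>\<^sub>L real"
    obtain a b where "a \<in> A" "\<forall>y\<in>A. x' y \<le> x' a" "b \<in> A" "\<forall>y\<in>A. (- x') y \<le> (- x') b"
      using weakly_compact_attains_sup[OF assms False] by meson
    then have "\<forall>y\<in>A. \<bar>x' y\<bar> \<le> \<bar>x' a\<bar> + \<bar>x' b\<bar>"
      by (fastforce simp: blinfun.minus_left abs_if)
    then show "\<exists>M. \<forall>y\<in>A. \<bar>x' y\<bar> \<le> M" by blast
  qed
qed auto

lemma cwk_imp_weakly_compact:
  assumes "K \<in> cwk"
  shows "weakly_compact K"
proof -
  have "continuous_map weak_topology euclidean (\<lambda>x. blinfun_apply x' x)" for x' :: "'a \<Rightarrow>\<^sub>L real"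
  proof -
    have top: "topspace (weak_topology :: 'a topology) = UNIV"
    proof -
      have "(UNIV :: 'a set) = blinfun_apply (0 :: 'a \<Rightarrow>\<^sub>L real) -` UNIV" by simp
      then have "(UNIV :: 'a set) \<in> {blinfun_apply x' -` U | (x' :: 'a \<Rightarrow>\<^sub>L real) U. open U}"
        using open_UNIV by blast
      then show ?thesis unfolding weak_topology_def topology_generated_by_topspace by blast
    qed
    show ?thesis
      unfolding continuous_map top
    proof (intro conjI allI impI)
      fix U :: "real set" assume "openin euclidean U"
      then have "blinfun_apply x' -` U \<in> {blinfun_apply x' -` U | (x' :: 'a \<Rightarrow>\<^sub>L real) U. open U}"
        by auto
      then have "openin weak_topology (blinfun_apply x' -` U)"
        unfolding weak_topology_def by (rule topology_generated_by_Basis)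
      then show "openin weak_topology {x \<in> UNIV. x' x \<in> U}" by (simp add: vimage_def)
    qed simp
  qed
  then have "continuous_map weak_topology (product_topology (\<lambda>_. euclidean) UNIV)
      (evaluation :: 'a \<Rightarrow> _)"
    by (simp add: continuous_map_componentwise_UNIV)
  then have "compactin euclidean (evaluation ` K)"
    using assms image_compactin unfolding cwk_def euclidean_product_topology by blast
  then show ?thesis by (simp add: weakly_compact_def)
qed

definition support :: "('a::real_normed_vector \<Rightarrow>\<^sub>L real) \<Rightarrow> 'a set \<Rightarrow> real" where
  "support x' A = (SUP a\<in>A. x' a)"

text \<open>
By the Hahn-Banach theorem the linear functionals below the support function of \<open>A\<close> are the points of
the closed convex hull of \<open>A\<close> in the algebraic dual of the dual space, for pointwise convergence. So this
says that \<open>A\<close> is its own closed convex hull there. The property passes easily to Minkowski sums and Hausdorff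
limits, where a direct proof of weak compactness would be harder.
\<close>

definition bidual_closed :: "'a::real_normed_vector set \<Rightarrow> bool" where
  "bidual_closed A \<longleftrightarrow> A \<noteq> {} \<and> (\<forall>x' :: 'a \<Rightarrow>\<^sub>L real. bdd_above (blinfun_apply x' ` A)) \<and>
     (\<forall>l. linear l \<longrightarrow> (\<forall>x'. l x' \<le> support x' A) \<longrightarrow> (\<exists>a\<in>A. l = evaluation a))"

lemma bidual_closed_nonempty: "bidual_closed A \<Longrightarrow> A \<noteq> {}"
  by (simp add: bidual_closed_def)

lemma bidual_closed_bdd:
  fixes x' :: "'a::real_normed_vector \<Rightarrow>\<^sub>L real"
  shows "bidual_closed A \<Longrightarrow> bdd_above (blinfun_apply x' ` A)"
  by (simp add: bidual_closed_def)

lemma bidual_closed_represent: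
  "bidual_closed A \<Longrightarrow> linear l \<Longrightarrow> (\<And>x'. l x' \<le> support x' A) \<Longrightarrow> \<exists>a\<in>A. l = evaluation a"
  by (simp add: bidual_closed_def)

lemma support_ge:
  "bdd_above (blinfun_apply x' ` A) \<Longrightarrow> a \<in> A \<Longrightarrow> x' a \<le> support x' A"
  unfolding support_def by (rule cSUP_upper)

lemma support_le:
  fixes x' :: "'a::real_normed_vector \<Rightarrow>\<^sub>L real"
  shows "A \<noteq> {} \<Longrightarrow> (\<And>a. a \<in> A \<Longrightarrow> x' a \<le> b) \<Longrightarrow> support x' A \<le> b"
  unfolding support_def by (rule cSUP_least)

lemma support_eq_max:
  assumes "a \<in> A" "\<And>b. b \<in> A \<Longrightarrow> blinfun_apply x' b \<le> blinfun_apply x' a"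
  shows "support x' A = x' a"
  unfolding support_def using assms by (intro cSup_eq_maximum) auto

lemma linear_evaluation: "linear (evaluation x)"
  by (rule linearI) (auto simp: blinfun.add_left blinfun.scaleR_left)

lemma sublinear_support:
  fixes A :: "'a::real_normed_vector set"
  assumes "A \<noteq> {}" "\<And>x' :: 'a \<Rightarrow>\<^sub>L real. bdd_above (blinfun_apply x' ` A)"
  shows "sublinear (\<lambda>x'. support x' A)"
proof (rule sublinearI)
  show "support 0 A = 0" unfolding support_def using assms(1) by simp
  show "support (x' + y') A \<le> support x' A + support y' A" for x' y'
    using support_ge[OF assms(2)]
    by (intro support_le assms(1)) (simp add: blinfun.add_left add_mono)
  show "support (t *\<^sub>R x') A \<le> t * support x' A" if "t > 0" for t x'
    using support_ge[OF assms(2)] that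
    by (intro support_le assms(1)) (simp add: blinfun.scaleR_left)
qed

text \<open>
Domination survives cutting \<open>K\<close> with the hyperplane on which \<open>z'\<close> takes the value prescribed by \<open>l\<close>. Only
two functionals are involved, so the statement reduces to separating a ray from the compact convex image
of \<open>K\<close> in the plane.
\<close>

lemma dominated_functional_on_slice:
  fixes K :: "'a::real_normed_vector set" and l :: "('a \<Rightarrow>\<^sub>L real) \<Rightarrow> real"
  assumes conv: "convex K" and wc: "weakly_compact K" and l: "linear l"
    and dom: "\<And>y'. \<exists>a\<in>K. l y' \<le> blinfun_apply y' a"
  shows "\<exists>a\<in>K. blinfun_apply z' a = l z' \<and> l y' \<le> blinfun_apply y' a"
proof (rule ccontr)
  assume contra: "\<not> ?thesis"
  define S :: "(real \<times> real) set" where "S = {l z'} \<times> {l y'..}"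
  define T where "T = (\<lambda>a. (blinfun_apply z' a, blinfun_apply y' a)) ` K"
  have "\<exists>a b. (\<forall>x\<in>S. inner a x < b) \<and> (\<forall>x\<in>T. inner a x > b)"
  proof (rule separating_hyperplane_closed_compact)
    show "convex S" "closed S"
      unfolding S_def by (auto intro: convex_Times closed_Times)
    have "linear (\<lambda>a. (blinfun_apply z' a, blinfun_apply y' a))"
      by (rule linearI) (auto simp: blinfun.add_right blinfun.scaleR_right)
    then show "convex T" unfolding T_def using conv by (rule convex_linear_image)
    have "compact ((\<lambda>l. (l z', l y')) ` evaluation ` K)"
      using wc unfolding weakly_compact_def
      by (rule compact_continuous_image[rotated])
        (intro continuous_on_Pair continuous_on_subset[OF continuous_on_product_coordinates subset_UNIV])
    moreover have "(\<lambda>l. (l z', l y')) ` evaluation ` K = T" by (auto simp: T_def image_iff)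
    ultimately show "compact T" by simp
    show "T \<noteq> {}" using dom by (auto simp: T_def)
    show "S \<inter> T = {}" using contra by (auto simp: S_def T_def)
  qed
  then obtain \<alpha> \<beta> b where sep: "\<And>x. x \<in> S \<Longrightarrow> inner (\<alpha>, \<beta>) x < b"
    "\<And>x. x \<in> T \<Longrightarrow> inner (\<alpha>, \<beta>) x > b" by (metis surj_pair)
  obtain a where a: "a \<in> K" "l (- (\<alpha> *\<^sub>R z' + \<beta> *\<^sub>R y')) \<le> (- (\<alpha> *\<^sub>R z' + \<beta> *\<^sub>R y')) a"
    using dom by blast
  have "\<alpha> * l z' + \<beta> * l y' < b" using sep(1)[of "(l z', l y')"] by (simp add: S_def)
  moreover have "b < \<alpha> * z' a + \<beta> * y' a" using sep(2)[of "(z' a, y' a)"] a(1) by (simp add: T_def)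
  moreover have "\<alpha> * z' a + \<beta> * y' a \<le> \<alpha> * l z' + \<beta> * l y'"
    using a(2) by (simp add: linear_neg[OF l] linear_add[OF l] linear_scale[OF l]
        linear_diff[OF l] blinfun.minus_left blinfun.add_left blinfun.diff_left blinfun.scaleR_left)
  ultimately show False by simp
qed

text \<open>
Cutting with one hyperplane after another gives, for finitely many functionals, a point of \<open>K\<close> at which
they agree with \<open>l\<close>; compactness gives one point for all functionals.
\<close>

lemma convex_weakly_compact_imp_bidual_closed:
  fixes K :: "'a::real_normed_vector set"
  assumes ne: "K \<noteq> {}" and conv: "convex K" and wc: "weakly_compact K"
  shows "bidual_closed K"
  unfolding bidual_closed_def
proof (intro conjI allI impI)
  show "K \<noteq> {}" by (rule ne)
  show "bdd_above (blinfun_apply x' ` K)" for x' :: "'a \<Rightarrow>\<^sub>L real"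
    using weakly_compact_attains_sup[OF wc ne, of x'] by (auto simp: bdd_above_def)
  fix l :: "('a \<Rightarrow>\<^sub>L real) \<Rightarrow> real"
  assume l: "linear l" and dom: "\<forall>x'. l x' \<le> support x' K"
  have dom': "\<exists>a\<in>K. l y' \<le> blinfun_apply y' a" for y'
  proof -
    obtain a where a: "a \<in> K" "\<And>b. b \<in> K \<Longrightarrow> y' b \<le> y' a"
      using weakly_compact_attains_sup[OF wc ne, of y'] by blast
    then show ?thesis using dom support_eq_max[OF a] by metis
  qed
  have slice: "\<exists>a\<in>K. (\<forall>x'\<in>F. blinfun_apply x' a = l x') \<and> l y' \<le> blinfun_apply y' a" if "finite F" for F y'
    using that
  proof (induction F arbitrary: y')
    case empty
    then show ?case using dom' by simp
  next
    case (insert z' F)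
    define KF where "KF = {x\<in>K. evaluation x \<in> (\<Inter>x'\<in>F. {l'. l' x' = l x'})}"
    have KF: "x \<in> KF \<longleftrightarrow> x \<in> K \<and> (\<forall>x'\<in>F. blinfun_apply x' x = l x')" for x by (auto simp: KF_def)
    have "\<exists>a\<in>KF. blinfun_apply z' a = l z' \<and> l y' \<le> blinfun_apply y' a"
    proof (rule dominated_functional_on_slice)
      show "convex KF"
      proof (rule convexI)
        fix x y u v assume "x \<in> KF" "y \<in> KF" and uv: "(0::real) \<le> u" "0 \<le> v" "u + v = 1"
        then show "u *\<^sub>R x + v *\<^sub>R y \<in> KF"
          using convexD[OF conv, of x y u v]
          by (simp add: KF blinfun.add_right blinfun.scaleR_right flip: distrib_right)
      qed
      show "weakly_compact KF" unfolding KF_def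
        by (intro weakly_compact_Int_closed wc closed_INT ballI closed_Collect_coordinate_eq)
      show "linear l" by (rule l)
      show "\<exists>a\<in>KF. l y' \<le> blinfun_apply y' a" for y'
        using insert.IH[of y'] by (auto simp: KF)
    qed
    then show ?case by (auto simp: KF)
  qed
  have "\<exists>a\<in>K. \<forall>x'\<in>UNIV. evaluation a \<in> {l'. l' x' = l x'}"
  proof (rule weakly_compact_fip[OF wc])
    show "closed {l'. l' x' = l x'}" for x' :: "'a \<Rightarrow>\<^sub>L real"
      by (rule closed_Collect_coordinate_eq)
    show "\<exists>a\<in>K. \<forall>x'\<in>F. evaluation a \<in> {l'. l' x' = l x'}" if "finite F" for F
      using slice[OF that, of 0] by auto
  qed
  then obtain a where "a \<in> K" "\<And>x'. blinfun_apply x' a = l x'" by auto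
  then show "\<exists>a\<in>K. l = evaluation a" by (intro bexI[of _ a]) (simp_all add: fun_eq_iff)
qed

text \<open>
The image of \<open>A\<close> consists of all linear functionals in a product of compact intervals, and linearity is
a closed condition.
\<close>

lemma bidual_closed_imp_weakly_compact:
  fixes A :: "'a::real_normed_vector set"
  assumes A: "bidual_closed A"
  shows "weakly_compact A"
proof -
  define B :: "(('a \<Rightarrow>\<^sub>L real) \<Rightarrow> real) set"
    where "B = PiE UNIV (\<lambda>x'. {- support (- x') A..support x' A})"
  define C :: "(('a \<Rightarrow>\<^sub>L real) \<Rightarrow> real) set"
    where "C = (\<Inter>x'. \<Inter>y'. {l. l (x' + y') = l x' + l y'}) \<inter> (\<Inter>t. \<Inter>x'. {l. l (t *\<^sub>R x') = t * l x'})"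
  have C: "l \<in> C \<longleftrightarrow> linear l" for l
    by (auto simp: C_def linear_iff)
  have "compactin (product_topology (\<lambda>_. euclidean) UNIV) B"
    unfolding B_def by (subst compactin_PiE) simp
  then have "compact B" unfolding euclidean_product_topology by simp
  moreover have "closed C"
    unfolding C_def
    by (intro closed_Int closed_INT ballI closed_Collect_eq continuous_intros) simp_all
  ultimately have "compact (B \<inter> C)" by (rule compact_Int_closed)
  moreover have "evaluation ` A = B \<inter> C"
  proof (intro equalityI subsetI)
    fix l assume "l \<in> evaluation ` A"
    then obtain a where a: "a \<in> A" "l = evaluation a" by blast
    have "- support (- x') A \<le> x' a" "x' a \<le> support x' A" for x' :: "'a \<Rightarrow>\<^sub>L real"
      using support_ge[OF bidual_closed_bdd[OF A] a(1), of x']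
        support_ge[OF bidual_closed_bdd[OF A] a(1), of "- x'"] by (auto simp: blinfun.minus_left)
    then show "l \<in> B \<inter> C" using linear_evaluation[of a] by (simp add: C B_def a(2) PiE_iff)
  next
    fix l assume "l \<in> B \<inter> C"
    then have "linear l" "\<And>x'. l x' \<le> support x' A" by (auto simp: C B_def PiE_iff)
    then show "l \<in> evaluation ` A" using bidual_closed_represent[OF A] by blast
  qed
  ultimately show ?thesis by (simp add: weakly_compact_def)
qed

text \<open>
The cone of lower constraints is the hypograph of \<open>l - q\<close>.
\<close>

lemma linear_functional_split:
  fixes l :: "'v::real_vector \<Rightarrow> real"
  assumes l: "linear l" and p: "sublinear p" and q: "sublinear q" and dom: "\<And>x. l x \<le> p x + q x"
  obtains l1 where "linear l1" "\<And>x. l1 x \<le> p x" "\<And>x. l x - l1 x \<le> q x"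
proof -
  obtain l1 where l1: "linear l1" "\<And>x. l1 x \<le> p x" "\<And>y c. (y, c) \<in> {(y, c). c \<le> l y - q y} \<Longrightarrow> c \<le> l1 y"
  proof (rule sandwich_cone[OF p, of "{(y, c). c \<le> l y - q y}"])
    show "(0, 0) \<in> {(y, c). c \<le> l y - q y}" by (simp add: linear_0[OF l] sublinear_zero[OF q])
    show "(y + y', c + c') \<in> {(y, c). c \<le> l y - q y}"
      if "(y, c) \<in> {(y, c). c \<le> l y - q y}" "(y', c') \<in> {(y, c). c \<le> l y - q y}" for y c y' c'
      using that sublinear_add[OF q, of y y'] by (simp add: linear_add[OF l])
    show "(t *\<^sub>R y, t * c) \<in> {(y, c). c \<le> l y - q y}"
      if "t > 0" "(y, c) \<in> {(y, c). c \<le> l y - q y}" for t y c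
      using that mult_left_mono[of c "l y - q y" t]
      by (simp add: linear_scale[OF l] sublinear_scale[OF q] right_diff_distrib)
    show "c \<le> p y" if "(y, c) \<in> {(y, c). c \<le> l y - q y}" for y c
      using that dom[of y] by simp
  qed blast
  have "l x - l1 x \<le> q x" for x
    using l1(3)[of x "l x - q x"] by simp
  with l1(1,2) show thesis by (rule that)
qed

lemma
  fixes A B :: "'a::real_normed_vector set"
  assumes A: "bidual_closed A" and B: "bidual_closed B"
  shows support_plus: "support x' (A + B) = support x' A + support x' B"
    and bidual_closed_plus: "bidual_closed (A + B)"
proof -
  note gA = support_ge[OF bidual_closed_bdd[OF A]] and gB = support_ge[OF bidual_closed_bdd[OF B]]
  have ne: "A + B \<noteq> {}" using bidual_closed_nonempty[OF A] bidual_closed_nonempty[OF B]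
    by (auto simp: set_plus_def)
  have le: "blinfun_apply x' c \<le> support x' A + support x' B" if "c \<in> A + B" for x' c
    using that gA gB by (auto simp: set_plus_def blinfun.add_right intro!: add_mono)
  then have bdd: "bdd_above (blinfun_apply x' ` (A + B))" for x' :: "'a \<Rightarrow>\<^sub>L real"
    by (intro bdd_aboveI[of _ "support x' A + support x' B"]) auto
  show eq: "support x' (A + B) = support x' A + support x' B" for x'
  proof (rule antisym)
    show "support x' (A + B) \<le> support x' A + support x' B" using ne le by (rule support_le)
    have "support x' A \<le> support x' (A + B) - support x' B"
    proof (rule support_le[OF bidual_closed_nonempty[OF A]])
      fix a assume a: "a \<in> A"
      have "support x' B \<le> support x' (A + B) - x' a"
      proof (rule support_le[OF bidual_closed_nonempty[OF B]])
        fix b assume "b \<in> B"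
        then have "a + b \<in> A + B" using a by auto
        from support_ge[OF bdd this] show "x' b \<le> support x' (A + B) - x' a"
          by (simp add: blinfun.add_right algebra_simps)
      qed
      then show "x' a \<le> support x' (A + B) - support x' B" by simp
    qed
    then show "support x' A + support x' B \<le> support x' (A + B)" by simp
  qed
  show "bidual_closed (A + B)"
    unfolding bidual_closed_def
  proof (intro conjI allI impI)
    show "A + B \<noteq> {}" by (rule ne)
    show "bdd_above (blinfun_apply x' ` (A + B))" for x' :: "'a \<Rightarrow>\<^sub>L real" by (rule bdd)
    fix l :: "('a \<Rightarrow>\<^sub>L real) \<Rightarrow> real"
    assume l: "linear l" and dom: "\<forall>x'. l x' \<le> support x' (A + B)"
    obtain l1 where l1: "linear l1" "\<And>x'. l1 x' \<le> support x' A" "\<And>x'. l x' - l1 x' \<le> support x' B"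
      using linear_functional_split[OF l
          sublinear_support[OF bidual_closed_nonempty[OF A] bidual_closed_bdd[OF A]]
          sublinear_support[OF bidual_closed_nonempty[OF B] bidual_closed_bdd[OF B]]] dom
      by (auto simp: eq)
    obtain a where a: "a \<in> A" "l1 = evaluation a" using bidual_closed_represent[OF A l1(1,2)] by blast
    obtain b where b: "b \<in> B" "(\<lambda>x'. l x' - l1 x') = evaluation b"
      using bidual_closed_represent[OF B linear_compose_sub[OF l l1(1)] l1(3)] by blast
    have "l x' = x' (a + b)" for x' :: "'a \<Rightarrow>\<^sub>L real"
      using fun_cong[OF b(2), of x'] by (simp add: a(2) blinfun.add_right)
    then show "\<exists>c\<in>A + B. l = evaluation c" using a(1) b(1)
      by (intro bexI[of _ "a + b"]) (auto simp: fun_eq_iff)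
  qed
qed

lemma bidual_closed_singleton: "bidual_closed {a :: 'a::real_normed_vector}"
proof -
  have "compact {evaluation a}" by simp
  then show ?thesis
    by (intro convex_weakly_compact_imp_bidual_closed) (auto simp: weakly_compact_def)
qed

lemma
  fixes A :: "'a::real_normed_vector set"
  assumes A: "bidual_closed A" and t: "t \<ge> 0"
  shows support_scaleR: "support x' ((\<lambda>x. t *\<^sub>R x) ` A) = t * support x' A"
    and bidual_closed_scaleR: "bidual_closed ((\<lambda>x. t *\<^sub>R x) ` A)"
proof -
  note gA = support_ge[OF bidual_closed_bdd[OF A]]
  have ne: "(\<lambda>x. t *\<^sub>R x) ` A \<noteq> {}" using bidual_closed_nonempty[OF A] by simp
  have le: "blinfun_apply x' c \<le> t * support x' A" if "c \<in> (\<lambda>x. t *\<^sub>R x) ` A" for x' c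
    using that gA t by (auto simp: blinfun.scaleR_right intro!: mult_left_mono)
  then have bdd: "bdd_above (blinfun_apply x' ` (\<lambda>x. t *\<^sub>R x) ` A)" for x' :: "'a \<Rightarrow>\<^sub>L real"
    by (intro bdd_aboveI[of _ "t * support x' A"]) blast
  show eq: "support x' ((\<lambda>x. t *\<^sub>R x) ` A) = t * support x' A" for x'
  proof (rule antisym)
    show "support x' ((\<lambda>x. t *\<^sub>R x) ` A) \<le> t * support x' A" using ne le by (rule support_le)
    show "t * support x' A \<le> support x' ((\<lambda>x. t *\<^sub>R x) ` A)"
    proof (cases "t = 0")
      case True
      then show ?thesis using bidual_closed_nonempty[OF A] by (simp add: support_def image_image)
    next
      case False
      with t have t': "t > 0" by simp
      have "support x' A \<le> support x' ((\<lambda>x. t *\<^sub>R x) ` A) / t"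
      proof (rule support_le[OF bidual_closed_nonempty[OF A]])
        fix a assume "a \<in> A"
        then have "t *\<^sub>R a \<in> (\<lambda>x. t *\<^sub>R x) ` A" by (rule imageI)
        from support_ge[OF bdd this, of x'] t' show "x' a \<le> support x' ((\<lambda>x. t *\<^sub>R x) ` A) / t"
          by (simp add: blinfun.scaleR_right field_simps)
      qed
      then show ?thesis using t' by (simp add: field_simps)
    qed
  qed
  show "bidual_closed ((\<lambda>x. t *\<^sub>R x) ` A)"
  proof (cases "t = 0")
    case True
    then have "(\<lambda>x. t *\<^sub>R x) ` A = {0}" using bidual_closed_nonempty[OF A] by auto
    then show ?thesis using bidual_closed_singleton by simp
  next
    case False
    with t have t': "t > 0" by simp
    show ?thesis
      unfolding bidual_closed_def
    proof (intro conjI allI impI)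
      show "(\<lambda>x. t *\<^sub>R x) ` A \<noteq> {}" by (rule ne)
      show "bdd_above (blinfun_apply x' ` (\<lambda>x. t *\<^sub>R x) ` A)" for x' :: "'a \<Rightarrow>\<^sub>L real" by (rule bdd)
      fix l :: "('a \<Rightarrow>\<^sub>L real) \<Rightarrow> real"
      assume l: "linear l" and dom: "\<forall>x'. l x' \<le> support x' ((\<lambda>x. t *\<^sub>R x) ` A)"
      have "inverse t * l x' \<le> support x' A" for x'
        using dom t' by (simp add: eq field_simps)
      moreover have "linear (\<lambda>x'. inverse t * l x')"
        using linear_compose_scale_right[OF l, of "inverse t"] by simp
      ultimately obtain a where a: "a \<in> A" "(\<lambda>x'. inverse t * l x') = evaluation a"
        using bidual_closed_represent[OF A] by blast
      have "l x' = x' (t *\<^sub>R a)" for x' :: "'a \<Rightarrow>\<^sub>L real"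
        using fun_cong[OF a(2), of x'] t' by (simp add: blinfun.scaleR_right field_simps)
      then show "\<exists>c\<in>(\<lambda>x. t *\<^sub>R x) ` A. l = evaluation c" using a(1)
        by (intro bexI[of _ "t *\<^sub>R a"]) (auto simp: fun_eq_iff)
    qed
  qed
qed

text \<open>
A functional dominated by the support function of \<open>A\<close> is dominated by \<open>support x' R + \<epsilon> * norm x'\<close>.
Splitting it accordingly places it within \<open>\<epsilon>\<close> of an evaluation at a point of \<open>R\<close>. As \<open>\<epsilon>\<close> tends to zero
these points form a Cauchy sequence, and its limit lies in \<open>A\<close> by separation.
\<close>

lemma bidual_closed_limit:
  fixes A :: "'a::banach set"
  assumes ne: "A \<noteq> {}" and cl: "closed A" and conv: "convex A"
    and approx: "\<And>\<epsilon>. \<epsilon> > 0 \<Longrightarrow> \<exists>R. bidual_closed R \<and> (\<forall>a\<in>A. \<exists>r\<in>R. norm (a - r) \<le> \<epsilon>)"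
  shows "bidual_closed A"
proof -
  have near: "blinfun_apply x' a \<le> support x' R + \<epsilon> * norm x'"
    if R: "bidual_closed R" and "\<forall>a\<in>A. \<exists>r\<in>R. norm (a - r) \<le> \<epsilon>" "a \<in> A" for R \<epsilon> a x'
  proof -
    from that obtain r where r: "r \<in> R" "norm (a - r) \<le> \<epsilon>" by blast
    have "x' a = x' r + x' (a - r)" by (simp add: blinfun.diff_right)
    also have "x' r \<le> support x' R" using support_ge[OF bidual_closed_bdd[OF R] r(1)] .
    also have "x' (a - r) \<le> \<epsilon> * norm x'"
      using blinfun_le_norm[of x' "a - r"] mult_left_mono[OF r(2), of "norm x'"] by (simp add: mult.commute)
    finally show ?thesis by simp
  qed
  obtain R1 where R1: "bidual_closed R1" "\<forall>a\<in>A. \<exists>r\<in>R1. norm (a - r) \<le> 1" using approx[of 1] by auto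
  have bdd: "bdd_above (blinfun_apply x' ` A)" for x' :: "'a \<Rightarrow>\<^sub>L real"
    using near[OF R1] by (intro bdd_aboveI[of _ "support x' R1 + 1 * norm x'"]) auto
  show ?thesis
    unfolding bidual_closed_def
  proof (intro conjI allI impI)
    show "A \<noteq> {}" by (rule ne)
    show "bdd_above (blinfun_apply x' ` A)" for x' :: "'a \<Rightarrow>\<^sub>L real" by (rule bdd)
    fix l :: "('a \<Rightarrow>\<^sub>L real) \<Rightarrow> real"
    assume l: "linear l" and dom: "\<forall>x'. l x' \<le> support x' A"
    have "\<exists>v. \<forall>x'. \<bar>l x' - blinfun_apply x' v\<bar> \<le> \<epsilon> * norm x'" if e: "\<epsilon> > 0" for \<epsilon>
    proof -
      obtain R where R: "bidual_closed R" "\<forall>a\<in>A. \<exists>r\<in>R. norm (a - r) \<le> \<epsilon>" using approx[OF e] by auto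
      have "l x' \<le> support x' R + \<epsilon> * norm x'" for x'
        using support_le[OF ne near[OF R, of _ x']] dom[rule_format, of x'] by simp
      moreover have "sublinear (\<lambda>x' :: 'a \<Rightarrow>\<^sub>L real. \<epsilon> * norm x')"
        using e by (auto simp: sublinear_def norm_triangle_ineq simp flip: distrib_left)
      ultimately obtain l1 where l1: "linear l1" "\<And>x'. l1 x' \<le> support x' R" "\<And>x'. l x' - l1 x' \<le> \<epsilon> * norm x'"
        using linear_functional_split[OF l
            sublinear_support[OF bidual_closed_nonempty[OF R(1)] bidual_closed_bdd[OF R(1)]]]
        by (metis (no_types, lifting))
      obtain v where v: "v \<in> R" "l1 = evaluation v"
        using bidual_closed_represent[OF R(1) l1(1,2)] by blast
      have "\<bar>l x' - blinfun_apply x' v\<bar> \<le> \<epsilon> * norm x'" for x'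
        using l1(3)[of x'] l1(3)[of "- x'"] linear_neg[OF l, of x'] v(2) by (simp add: blinfun.minus_left)
      then show ?thesis by blast
    qed
    then have "\<exists>v. \<forall>n x'. \<bar>l x' - blinfun_apply x' (v n)\<bar> \<le> inverse (real (Suc n)) * norm x'"
      by (intro choice allI) simp
    then obtain v where v: "\<And>n x'. \<bar>l x' - blinfun_apply x' (v n)\<bar> \<le> inverse (real (Suc n)) * norm x'"
      by blast
    have dist: "norm (v m - v n) \<le> inverse (real (Suc m)) + inverse (real (Suc n))" for m n
    proof -
      obtain x' :: "'a \<Rightarrow>\<^sub>L real" where x': "norm x' \<le> 1" "x' (v m - v n) = norm (v m - v n)"
        by (rule norming_functional)
      have "inverse (real (Suc k)) * norm x' \<le> inverse (real (Suc k))" for k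
        using x'(1) by (simp add: mult_left_le)
      then have "\<bar>l x' - x' (v k)\<bar> \<le> inverse (real (Suc k))" for k
        using v[of x' k] order_trans by blast
      from this[of m] this[of n] x'(2) show ?thesis by (simp add: blinfun.diff_right)
    qed
    have "Cauchy v"
    proof (rule metric_CauchyI)
      fix e :: real assume "e > 0"
      then obtain N where N: "inverse (real (Suc N)) < e / 2"
        using reals_Archimedean[of "e / 2"] by auto
      have "dist (v m) (v n) < e" if "m \<ge> N" "n \<ge> N" for m n
      proof -
        have "inverse (real (Suc m)) \<le> inverse (real (Suc N))" "inverse (real (Suc n)) \<le> inverse (real (Suc N))"
          using that by (auto intro!: le_imp_inverse_le)
        then show ?thesis using dist[of m n] N unfolding dist_norm by linarith
      qed
      then show "\<exists>M. \<forall>m\<ge>M. \<forall>n\<ge>M. dist (v m) (v n) < e" by blast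
    qed
    then obtain a where a: "v \<longlonglongrightarrow> a" using Cauchy_convergent_iff convergent_def by blast
    have la: "l x' = blinfun_apply x' a" for x'
    proof -
      have "(\<lambda>n. l x' - x' (v n)) \<longlonglongrightarrow> 0"
      proof (rule Lim_null_comparison)
        show "\<forall>\<^sub>F n in sequentially. norm (l x' - x' (v n)) \<le> inverse (real (Suc n)) * norm x'"
          using v by simp
        show "(\<lambda>n. inverse (real (Suc n)) * norm x') \<longlonglongrightarrow> 0"
          using tendsto_mult_left_zero[OF LIMSEQ_inverse_real_of_nat] .
      qed
      moreover have "(\<lambda>n. l x' - x' (v n)) \<longlonglongrightarrow> l x' - x' a"
        by (intro tendsto_intros a)
      ultimately show ?thesis using LIMSEQ_unique by fastforce
    qed
    have "a \<in> A"
    proof (rule ccontr)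
      assume "a \<notin> A"
      then obtain d where d: "d > 0" "ball a d \<subseteq> - A"
        using cl open_contains_ball[of "- A"] by blast
      have "d \<le> norm (a - c)" if "c \<in> A" for c
        using d(2) that by (force simp: dist_norm)
      then obtain x' :: "'a \<Rightarrow>\<^sub>L real" where "\<And>c. c \<in> A \<Longrightarrow> x' c + d \<le> x' a"
        using separation_distance[OF conv, of d a] by blast
      then have "support x' A \<le> x' a - d" using ne by (intro support_le) (auto simp: algebra_simps)
      with dom[rule_format, of x'] d(1) show False by (simp add: la)
    qed
    then show "\<exists>a\<in>A. l = evaluation a" using la by (auto simp: fun_eq_iff)
  qed
qed


section \<open>Small weakly open pieces and strongly exposed points\<close>

text \<open>
The closed linear span is the closure of the rational combinations. Only its convexity is recorded,
since a closed convex set is already weakly closed.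
\<close>

lemma separable_closed_convex_superset:
  fixes a :: "nat \<Rightarrow> 'a::real_normed_vector"
  obtains Q where "countable Q" "range a \<subseteq> closure Q" "convex (closure Q)"
proof -
  define comb where "comb l = (\<Sum>(q, n)\<leftarrow>l. of_rat q *\<^sub>R a n)" for l :: "(rat \<times> nat) list"
  define Q where "Q = range comb"
  have Q_add: "x + y \<in> Q" if "x \<in> Q" "y \<in> Q" for x y
  proof -
    from that obtain k l where "x = comb k" "y = comb l" by (auto simp: Q_def)
    then have "x + y = comb (k @ l)" by (simp add: comb_def)
    then show ?thesis by (simp add: Q_def)
  qed
  have Q_scale: "of_rat r *\<^sub>R x \<in> Q" if "x \<in> Q" for r x
  proof -
    from that obtain l where x: "x = comb l" by (auto simp: Q_def)
    have "of_rat r *\<^sub>R comb l = comb (map (\<lambda>(q, n). (r * q, n)) l)" for l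
      by (induction l) (auto simp: comb_def scaleR_add_right of_rat_mult)
    then show ?thesis by (simp add: Q_def x)
  qed
  have cl_add: "x + y \<in> closure Q" if "x \<in> closure Q" "y \<in> closure Q" for x y
  proof -
    from that obtain f g where "\<And>n. f n \<in> Q" "f \<longlonglongrightarrow> x" "\<And>n. g n \<in> Q" "g \<longlonglongrightarrow> y"
      unfolding closure_sequential by blast
    then show ?thesis unfolding closure_sequential
      by (intro exI[of _ "\<lambda>n. f n + g n"]) (auto intro: Q_add tendsto_add)
  qed
  have cl_scale: "c *\<^sub>R x \<in> closure Q" if x: "x \<in> closure Q" for c x
  proof -
    have rat: "of_rat r *\<^sub>R x \<in> closure Q" for r
    proof -
      from x obtain f where "\<And>n. f n \<in> Q" "f \<longlonglongrightarrow> x"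
        unfolding closure_sequential by blast
      then show ?thesis unfolding closure_sequential
        by (intro exI[of _ "\<lambda>n. of_rat r *\<^sub>R f n"]) (auto intro: Q_scale tendsto_scaleR)
    qed
    have "closed ((\<lambda>c. c *\<^sub>R x) -` closure Q)"
      by (intro closed_vimage closed_closure continuous_intros)
    moreover have "\<rat> \<subseteq> (\<lambda>c. c *\<^sub>R x) -` closure Q" using rat by (auto elim: Rats_cases)
    ultimately have "closure \<rat> \<subseteq> (\<lambda>c. c *\<^sub>R x) -` closure Q" by (intro closure_minimal)
    then show ?thesis unfolding Rats_closure_real by blast
  qed
  show thesis
  proof
    show "countable Q" by (simp add: Q_def)
    have "a n = comb [(1, n)]" for n by (simp add: comb_def)
    then have "a n \<in> Q" for n by (auto simp: Q_def)
    then show "range a \<subseteq> closure Q" using closure_subset[of Q] by blast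
    show "convex (closure Q)" by (rule convexI) (intro cl_add cl_scale)
  qed
qed

text \<open>
A closed convex set is an intersection of closed half-spaces, hence weakly closed.
\<close>

lemma weakly_compact_Int_closed_convex:
  fixes E :: "'a::real_normed_vector set"
  assumes E: "weakly_compact E" and C: "closed C" "convex C"
  shows "weakly_compact (E \<inter> C)"
proof -
  define B :: "(('a \<Rightarrow>\<^sub>L real) \<times> real) set" where "B = {z. \<forall>c\<in>C. blinfun_apply (fst z) c \<le> snd z}"
  define F :: "(('a \<Rightarrow>\<^sub>L real) \<Rightarrow> real) set" where "F = (\<Inter>z\<in>B. {l. l (fst z) \<le> snd z})"
  have "closed F" unfolding F_def
    by (intro closed_INT ballI closed_Collect_coordinate_le(1))
  moreover have "x \<in> C" if "evaluation x \<in> F" for x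
  proof (rule ccontr)
    assume "x \<notin> C"
    then obtain d where d: "d > 0" "ball x d \<subseteq> - C"
      using C(1) open_contains_ball[of "- C"] by blast
    have "d \<le> norm (x - c)" if "c \<in> C" for c
      using d(2) that by (force simp: dist_norm)
    then obtain x' :: "'a \<Rightarrow>\<^sub>L real" where "\<And>c. c \<in> C \<Longrightarrow> x' c + d \<le> x' x"
      using separation_distance[OF C(2), of d x] by blast
    then have "x' c \<le> x' x - d" if "c \<in> C" for c using that by (simp add: le_diff_eq)
    then have "(x', x' x - d) \<in> B" by (simp add: B_def)
    then have "evaluation x \<in> {l. l (fst (x', x' x - d)) \<le> snd (x', x' x - d)}"
      using that unfolding F_def by (rule INT_D[rotated])
    then show False using d(1) by simp
  qed
  moreover have "evaluation x \<in> F" if "x \<in> C" for x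
    using that by (simp add: F_def B_def)
  ultimately have "closed F" "E \<inter> C = {x\<in>E. evaluation x \<in> F}" by blast+
  then show ?thesis using weakly_compact_Int_closed[OF E, of F] by simp
qed

text \<open>
Otherwise every weakly open set meeting \<open>E\<close> contains two such sets on whose closures some functional of
norm at most one takes values that differ by at least \<open>\<epsilon>\<close>. Iterating gives a binary tree of weakly open sets \<open>T s\<close>, and by
compactness each of its uncountably many branches has a limit point in \<open>E\<close>. Distinct branches have limit
points at distance at least \<open>\<epsilon>\<close>. But the limit points can all be taken in the closed subspace
generated by one chosen point for each node, and that subspace is separable.
\<close>

lemma weakly_compact_fragment:
  fixes E :: "'a::real_normed_vector set"
  assumes E: "weakly_compact E" and ne: "E \<noteq> {}" and e: "\<epsilon> > 0"
  obtains W x where "open W" "\<exists>y\<in>E. evaluation y \<in> W"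
    "\<And>y. y \<in> E \<Longrightarrow> evaluation y \<in> W \<Longrightarrow> norm (y - x) \<le> \<epsilon>"
proof -
  define meets where "meets W \<longleftrightarrow> open W \<and> (\<exists>y\<in>E. evaluation y \<in> W)" for W
  have "\<exists>W. meets W \<and> (\<exists>x. \<forall>y\<in>E. evaluation y \<in> W \<longrightarrow> norm (y - x) \<le> \<epsilon>)"
  proof (rule ccontr)
    assume none: "\<not> ?thesis"
    define splits where "splits W V \<longleftrightarrow> (\<forall>i::bool. meets (V i) \<and> V i \<subseteq> W) \<and>
        (\<exists>x' c. norm x' \<le> 1 \<and> V True \<subseteq> {l. c + \<epsilon> \<le> l x'} \<and> V False \<subseteq> {l. l x' \<le> c})" for W V
    have "\<exists>V. splits W V" if W: "meets W" for W
    proof -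
      obtain v where v: "v \<in> E" "evaluation v \<in> W" using W by (auto simp: meets_def)
      with none W obtain u where u: "u \<in> E" "evaluation u \<in> W" "norm (u - v) > \<epsilon>"
        by (meson not_le)
      obtain x' :: "'a \<Rightarrow>\<^sub>L real" where x': "norm x' \<le> 1" "x' (u - v) = norm (u - v)"
        by (rule norming_functional)
      (* c and c + \<epsilon> are placed symmetrically between the values at v and u. *)
      define c where "c = (x' u + x' v - \<epsilon>) / 2"
      have c: "x' v < c" "c + \<epsilon> < x' u"
        using u(3) x'(2) by (auto simp: c_def blinfun.diff_right field_simps)
      define V where "V i = (if i then W \<inter> {l. c + \<epsilon> < l x'} else W \<inter> {l. l x' < c})" for i
      have "open W" using W by (simp add: meets_def)
      moreover have "open {l. c + \<epsilon> < l x'}" "open {l. l x' < c}"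
        by (intro open_Collect_less continuous_on_const continuous_on_product_coordinates)+
      ultimately have "open (V i)" for i unfolding V_def by (simp add: open_Int)
      moreover have "\<exists>y\<in>E. evaluation y \<in> V i" for i
      proof (cases i)
        case True
        then show ?thesis using u c by (intro bexI[of _ u]) (simp_all add: V_def)
      next
        case False
        then show ?thesis using v c by (intro bexI[of _ v]) (simp_all add: V_def)
      qed
      ultimately have "meets (V i)" for i by (simp add: meets_def)
      moreover have "V i \<subseteq> W" for i by (simp add: V_def)
      moreover have "V True \<subseteq> {l. c + \<epsilon> \<le> l x'}" "V False \<subseteq> {l. l x' \<le> c}"
        by (auto simp: V_def)
      ultimately have "splits W V" using x'(1) unfolding splits_def by blast
      then show ?thesis by blast
    qed
    then have "\<forall>W\<in>Collect meets. \<exists>V. splits W V" by simp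
    then have "\<exists>f. \<forall>W\<in>Collect meets. splits W (f W)" by (rule bchoice)
    then obtain f where f_splits: "\<And>W. meets W \<Longrightarrow> splits W (f W)" by auto
    have f: "\<And>W i. meets W \<Longrightarrow> meets (f W i)" "\<And>W i. meets W \<Longrightarrow> f W i \<subseteq> W"
      "\<And>W. meets W \<Longrightarrow> \<exists>x' c. norm x' \<le> 1 \<and> f W True \<subseteq> {l. c + \<epsilon> \<le> l x'} \<and> f W False \<subseteq> {l. l x' \<le> c}"
      using f_splits unfolding splits_def by blast+
    (* A node is the list of choices leading to it, the latest choice first. *)
    define T where "T s = foldr (\<lambda>i W. f W i) s UNIV" for s
    have T_Cons: "T (i # s) = f (T s) i" for i s by (simp add: T_def)
    have meets_T: "meets (T s)" for s
      by (induction s) (use ne in \<open>auto simp: T_Cons f(1)\<close>, auto simp: T_def meets_def)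
    then have "\<exists>y. y \<in> E \<and> evaluation y \<in> T s" for s
      unfolding meets_def by blast
    then obtain p where p: "\<And>s. p s \<in> E" "\<And>s. evaluation (p s) \<in> T s" by metis
    obtain Q where Q: "countable Q" "range (\<lambda>n. p (from_nat n)) \<subseteq> closure Q" "convex (closure Q)"
      by (rule separable_closed_convex_superset)
    have pQ: "p s \<in> closure Q" for s
    proof -
      have "p s = p (from_nat (to_nat s))" by simp
      then show ?thesis using Q(2) by blast
    qed
    define pre where "pre b n = rev (map b [0..<n])" for b :: "nat \<Rightarrow> bool" and n
    have pre_Suc: "pre b (Suc n) = b n # pre b n" for b n by (simp add: pre_def)
    have T_mono: "T (pre b n) \<subseteq> T (pre b m)" if "m \<le> n" for b m n
      using that by (induction rule: dec_induct) (use f(2) meets_T in \<open>auto simp: pre_Suc T_Cons\<close>)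
    have "\<exists>x\<in>E \<inter> closure Q. \<forall>n\<in>UNIV. evaluation x \<in> closure (T (pre b n))" for b
    proof (rule weakly_compact_fip)
      show "weakly_compact (E \<inter> closure Q)"
        using E closed_closure Q(3) by (rule weakly_compact_Int_closed_convex)
      show "closed (closure (T (pre b n)))" for n by simp
      show "\<exists>x\<in>E \<inter> closure Q. \<forall>n\<in>J. evaluation x \<in> closure (T (pre b n))" if "finite J" for J
      proof (intro bexI ballI)
        fix n assume "n \<in> J"
        then have "T (pre b (Max J)) \<subseteq> T (pre b n)" using that by (intro T_mono Max_ge)
        then show "evaluation (p (pre b (Max J))) \<in> closure (T (pre b n))"
          using p(2) closure_subset by blast
      qed (use p(1) pQ in auto)
    qed
    then have "\<exists>x. x \<in> E \<inter> closure Q \<and> (\<forall>n. evaluation x \<in> closure (T (pre b n)))" for b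
      by blast
    then obtain z where z: "\<And>b. z b \<in> E \<inter> closure Q" "\<And>b n. evaluation (z b) \<in> closure (T (pre b n))"
      by metis
    have sep: "\<epsilon> \<le> norm (z b - z b')" if "b \<noteq> b'" for b b'
    proof -
      (* The branches separate at the first place where they differ. *)
      define n where "n = (LEAST n. b n \<noteq> b' n)"
      from that obtain k where "b k \<noteq> b' k" by auto
      then have n: "b n \<noteq> b' n" and "\<And>m. m < n \<Longrightarrow> b m = b' m"
        unfolding n_def using LeastI[of "\<lambda>n. b n \<noteq> b' n"] not_less_Least by blast+
      then have same: "pre b n = pre b' n" by (simp add: pre_def)
      obtain x' c where x': "norm x' \<le> 1" "f (T (pre b n)) True \<subseteq> {l. c + \<epsilon> \<le> l x'}"
        "f (T (pre b n)) False \<subseteq> {l. l x' \<le> c}" using f(3)[OF meets_T] by blast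
      have "closure (f (T (pre b n)) True) \<subseteq> {l. c + \<epsilon> \<le> l x'}"
        using x'(2) closed_Collect_coordinate_le(2) by (rule closure_minimal)
      then have hi: "c + \<epsilon> \<le> x' x" if "evaluation x \<in> closure (f (T (pre b n)) True)" for x
        using that by fastforce
      have "closure (f (T (pre b n)) False) \<subseteq> {l. l x' \<le> c}"
        using x'(3) closed_Collect_coordinate_le(1) by (rule closure_minimal)
      then have lo: "x' x \<le> c" if "evaluation x \<in> closure (f (T (pre b n)) False)" for x
        using that by fastforce
      have "evaluation (z b) \<in> closure (f (T (pre b n)) (b n))"
        "evaluation (z b') \<in> closure (f (T (pre b n)) (b' n))"
        using z(2)[of b "Suc n"] z(2)[of b' "Suc n"] by (auto simp: pre_Suc T_Cons same)
      then have "\<epsilon> \<le> \<bar>x' (z b - z b')\<bar>"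
        using n hi[of "z b"] lo[of "z b'"] hi[of "z b'"] lo[of "z b"]
        by (cases "b n"; cases "b' n") (simp_all add: blinfun.diff_right)
      also have "\<dots> \<le> norm x' * norm (z b - z b')" using norm_blinfun[of x' "z b - z b'"] by simp
      also have "\<dots> \<le> norm (z b - z b')" using x'(1) by (simp add: mult_left_le_one_le)
      finally show ?thesis .
    qed
    have "z b \<in> closure Q" for b using z(1)[of b] by blast
    then have "\<exists>q\<in>Q. dist q (z b) < \<epsilon> / 2" for b
      unfolding closure_approachable using e half_gt_zero by blast
    then obtain q where q: "\<And>b. q b \<in> Q" "\<And>b. dist (q b) (z b) < \<epsilon> / 2" by metis
    have "inj q"
    proof (rule injI, rule ccontr)
      fix b b' assume "q b = q b'" "b \<noteq> b'"
      then have "dist (z b) (z b') < \<epsilon>"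
        using q(2)[of b] q(2)[of b'] dist_triangle2[of "z b" "z b'" "q b"] by (simp add: dist_commute)
      then show False using sep[OF \<open>b \<noteq> b'\<close>] by (simp add: dist_norm)
    qed
    moreover have "countable (range q)" using q(1) Q(1) by (blast intro: countable_subset)
    ultimately have "countable (UNIV :: (nat \<Rightarrow> bool) set)"
      by (simp add: countable_image_inj_eq)
    then obtain g :: "nat \<Rightarrow> nat \<Rightarrow> bool" where "range g = UNIV"
      using range_from_nat_into[of "UNIV :: (nat \<Rightarrow> bool) set"] by blast
    then obtain n where "g n = (\<lambda>n. \<not> g n n)" by (metis rangeE UNIV_I)
    then show False by (metis (full_types))
  qed
  then show thesis using that by (auto simp: meets_def)
qed

lemma compact_imp_closed_fun:
  fixes S :: "('i \<Rightarrow> real) set"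
  assumes "compact S"
  shows "closed S"
proof -
  have "Hausdorff_space (product_topology (\<lambda>_::'i. euclidean :: real topology) UNIV)"
    by (simp add: Hausdorff_space_product_topology)
  then show ?thesis
    using compactin_imp_closedin assms unfolding euclidean_product_topology by fastforce
qed

lemma inj_evaluation: "inj (evaluation :: 'a::real_normed_vector \<Rightarrow> _)"
proof (rule injI)
  fix x y :: 'a assume eq: "evaluation x = evaluation y"
  obtain x' :: "'a \<Rightarrow>\<^sub>L real" where "x' (x - y) = norm (x - y)" by (rule norming_functional)
  moreover have "x' x = x' y" using fun_cong[OF eq, of x'] by simp
  ultimately show "x = y" by (simp add: blinfun.diff_right)
qed

text \<open>
Let \<open>E\<close> be a minimal weakly compact subset of \<open>K\<close> on which every functional of \<open>U\<close> still attains its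
maximum over \<open>K\<close>, and let \<open>W\<close> cut out a piece of \<open>E\<close> of small diameter. By minimality the rest of \<open>E\<close> does
not suffice for some \<open>u\<close> in \<open>U\<close>: there the maximum over the rest is strictly smaller. Since \<open>K\<close> is
bounded, this persists for functionals near \<open>u\<close>, and these attain their maximum in the small piece.
\<close>

lemma maxima_localise:
  fixes K :: "'a::real_normed_vector set" and U :: "('a \<Rightarrow>\<^sub>L real) set"
  assumes K: "weakly_compact K" and ne: "K \<noteq> {}" and U: "open U" "U \<noteq> {}" and e: "\<epsilon> > 0"
  obtains V x where "open V" "V \<noteq> {}" "V \<subseteq> U"
    "\<And>w. w \<in> V \<Longrightarrow> \<exists>a\<in>K. norm (a - x) \<le> \<epsilon> \<and> (\<forall>k\<in>K. blinfun_apply w k \<le> w a)"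
proof -
  define A where "A = {E. E \<subseteq> K \<and> weakly_compact E \<and> (\<forall>u\<in>U. \<exists>e\<in>E. \<forall>k\<in>K. blinfun_apply u k \<le> u e)}"
  have KA: "K \<in> A" using K weakly_compact_attains_sup[OF K ne] by (auto simp: A_def)
  have "\<exists>E\<in>A. \<forall>E'\<in>A. E' \<subseteq> E \<longrightarrow> E' = E"
  proof (rule predicate_Zorn)
    show "partial_order_on A (relation_of (\<lambda>E E'. E' \<subseteq> E) A)"
      by (rule partial_order_on_relation_ofI) auto
    fix C assume "C \<in> Chains (relation_of (\<lambda>E E'. E' \<subseteq> E) A)"
    then have CA: "C \<subseteq> A" and chain: "subset.chain A C"
      by (auto simp: Chains_def relation_of_def subset_chain_def)
    show "\<exists>E\<in>A. \<forall>E'\<in>C. E \<subseteq> E'"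
    proof (cases "C = {}")
      case True
      then show ?thesis using KA by blast
    next
      case False
      have mem: "x \<in> E" if "evaluation x \<in> evaluation ` E" for x :: 'a and E
        using that inj_evaluation by (auto simp: inj_def)
      have cl: "closed (evaluation ` E)" if "E \<in> C" for E
        using that CA by (auto simp: A_def weakly_compact_def intro: compact_imp_closed_fun)
      define D where "D = {x\<in>K. evaluation x \<in> (\<Inter>E\<in>C. evaluation ` E)}"
      have "weakly_compact D" unfolding D_def
        by (intro weakly_compact_Int_closed K closed_INT ballI cl)
      moreover have D_sub: "D \<subseteq> E" if "E \<in> C" for E 
      proof
        fix x assume "x \<in> D"
        then have "evaluation x \<in> evaluation ` E" using that unfolding D_def by blast
        then show "x \<in> E" by (rule mem)
      qed
      moreover have "\<exists>e\<in>D. \<forall>k\<in>K. u k \<le> u e" if u: "u \<in> U" for u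
      proof -
        obtain a where a: "a \<in> K" "\<forall>k\<in>K. u k \<le> u a"
          using weakly_compact_attains_sup[OF K ne, of u] by blast
        have "\<exists>x\<in>K. \<forall>E\<in>C. evaluation x \<in> evaluation ` E \<inter> {l. u a \<le> l u}"
        proof (rule weakly_compact_fip[OF K])
          show "closed (evaluation ` E \<inter> {l. u a \<le> l u})" if "E \<in> C" for E
            using cl[OF that] closed_Collect_coordinate_le(2) by (rule closed_Int)
          fix J assume J: "finite J" "J \<subseteq> C"
          show "\<exists>x\<in>K. \<forall>E\<in>J. evaluation x \<in> evaluation ` E \<inter> {l. u a \<le> l u}"
          proof (cases "J = {}")
            case True
            then show ?thesis using ne by blast
          next
            case Jne: False
            have "subset.chain A J" using chain J(2) unfolding subset_chain_def by (meson subsetD subset_trans)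
            then have "\<Inter>J \<in> J" by (rule Inter_in_chain[OF J(1) Jne])
            then have "\<Inter>J \<in> A" using J(2) CA by blast
            then obtain x where "x \<in> \<Inter>J" "x \<in> K" "\<forall>k\<in>K. u k \<le> u x" using u unfolding A_def by blast
            then show ?thesis using a(1) by (intro bexI[of _ x]) auto
          qed
        qed
        then obtain x where x: "x \<in> K" "\<And>E. E \<in> C \<Longrightarrow> evaluation x \<in> evaluation ` E \<inter> {l. u a \<le> l u}"
          by blast
        then have "x \<in> D" by (auto simp: D_def)
        moreover have "u a \<le> u x" using False x(2) by auto
        ultimately show ?thesis using a(2) by (intro bexI[of _ x]) auto
      qed
      ultimately show ?thesis by (intro bexI[of _ D]) (auto simp: A_def D_def)
    qed
  qed
  then obtain E where EA: "E \<in> A" and E_min: "\<And>E'. E' \<in> A \<Longrightarrow> E' \<subseteq> E \<Longrightarrow> E' = E" by blast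
  have EK: "E \<subseteq> K" and Ewc: "weakly_compact E"
    and E_max: "\<And>u. u \<in> U \<Longrightarrow> \<exists>e\<in>E. \<forall>k\<in>K. blinfun_apply u k \<le> u e" using EA by (auto simp: A_def)
  have "E \<noteq> {}" using E_max U(2) by blast
  obtain W x where W: "open W" "\<exists>y\<in>E. evaluation y \<in> W"
    "\<And>y. y \<in> E \<Longrightarrow> evaluation y \<in> W \<Longrightarrow> norm (y - x) \<le> \<epsilon>"
    by (rule weakly_compact_fragment[OF Ewc \<open>E \<noteq> {}\<close> e]) (rule that)
  define E' where "E' = {y\<in>E. evaluation y \<in> - W}"
  have E'wc: "weakly_compact E'" unfolding E'_def
    using W(1) by (intro weakly_compact_Int_closed Ewc) auto
  have E'E: "E' \<subseteq> E" by (auto simp: E'_def)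
  have "E' \<noteq> E" using W(2) by (auto simp: E'_def)
  then have "E' \<notin> A" using E_min E'E by blast
  then obtain u where u: "u \<in> U" "\<And>e. e \<in> E' \<Longrightarrow> \<exists>k\<in>K. u e < u k"
    using E'wc E'E EK by (force simp: A_def not_le)
  obtain e0 where e0: "e0 \<in> E" "\<And>k. k \<in> K \<Longrightarrow> u k \<le> u e0" using E_max[OF u(1)] by blast
  have lt: "u e < u e0" if "e \<in> E'" for e using u(2)[OF that] e0(2) by fastforce
  obtain \<eta> where \<eta>: "\<eta> > 0" "\<And>e. e \<in> E' \<Longrightarrow> u e \<le> u e0 - \<eta>"
  proof (cases "E' = {}")
    case False
    then obtain e1 where "e1 \<in> E'" "\<forall>e\<in>E'. u e \<le> u e1" using weakly_compact_attains_sup[OF E'wc] by blast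
    then show thesis using lt[of e1] by (intro that[of "u e0 - u e1"]) auto
  qed (auto intro: that[of 1])
  obtain M where M: "M \<ge> 0" "\<And>k. k \<in> K \<Longrightarrow> norm k \<le> M" using weakly_compact_imp_bounded[OF K] by blast
  (* Moving the functional by less than r changes the values on K by less than half the gap \<eta>. *)
  define r where "r = \<eta> / (2 * M + 1)"
  have r: "r > 0" using \<eta>(1) M(1) by (simp add: r_def)
  show thesis
  proof
    show "open (U \<inter> ball u r)" "U \<inter> ball u r \<subseteq> U" "U \<inter> ball u r \<noteq> {}"
      using U(1) u(1) r by auto
    fix w assume w: "w \<in> U \<inter> ball u r"
    then obtain e1 where e1: "e1 \<in> E" "\<forall>k\<in>K. w k \<le> w e1" using E_max by blast
    have close: "\<bar>u k - w k\<bar> \<le> r * M" if "k \<in> K" for k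
    proof -
      have "\<bar>u k - w k\<bar> \<le> norm (u - w) * norm k"
        using norm_blinfun[of "u - w" k] by (simp add: blinfun.diff_left)
      also have "\<dots> \<le> r * M" using w M that r by (intro mult_mono) (auto simp: dist_norm)
      finally show ?thesis .
    qed
    have "evaluation e1 \<in> W"
    proof (rule ccontr)
      assume "evaluation e1 \<notin> W"
      then have "u e1 \<le> u e0 - \<eta>" using e1(1) by (intro \<eta>(2)) (simp add: E'_def)
      moreover have "w e0 \<le> w e1" using e1(2) e0(1) EK by blast
      moreover have "e0 \<in> K" "e1 \<in> K" using e0(1) e1(1) EK by auto
      ultimately have "\<eta> \<le> 2 * (r * M)" using close[of e0] close[of e1] by linarith
      moreover have "\<eta> = r * (2 * M + 1)" using M(1) by (simp add: r_def)
      then have "\<eta> = 2 * (r * M) + r" by (simp add: algebra_simps)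
      ultimately show False using r by linarith
    qed
    then show "\<exists>a\<in>K. norm (a - x) \<le> \<epsilon> \<and> (\<forall>k\<in>K. w k \<le> w a)"
      using W(3) e1 EK by blast
  qed
qed

text \<open>
For each \<open>\<epsilon>\<close> the functionals whose neighbours attain their maxima in one ball of radius \<open>\<epsilon>\<close> form an open
set, dense by \<open>maxima_localise\<close>; the dual is complete, so the Baire category theorem gives a
functional that works for every \<open>\<epsilon>\<close>.
\<close>

lemma generic_functional:
  fixes K :: "'a::real_normed_vector set"
  assumes K: "weakly_compact K" and ne: "K \<noteq> {}"
  obtains x' :: "'a \<Rightarrow>\<^sub>L real" where "\<And>\<epsilon>. \<epsilon> > 0 \<Longrightarrow> \<exists>x r. r > 0 \<and>
    (\<forall>w. norm (w - x') < r \<longrightarrow> (\<exists>a\<in>K. norm (a - x) \<le> \<epsilon> \<and> (\<forall>k\<in>K. blinfun_apply w k \<le> w a)))"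
proof -
  define good where "good V \<epsilon> \<longleftrightarrow>
    open V \<and> (\<exists>x. \<forall>w\<in>V. \<exists>a\<in>K. norm (a - x) \<le> \<epsilon> \<and> (\<forall>k\<in>K. blinfun_apply w k \<le> w a))"
    for V :: "('a \<Rightarrow>\<^sub>L real) set" and \<epsilon>
  define G where "G n = \<Union>{V. good V (inverse (real (Suc n)))}" for n
  have "open (G n)" for n by (auto simp: G_def good_def)
  moreover have "closure (G n) = UNIV" for n
  proof -
    have "G n \<inter> U \<noteq> {}" if U: "open U" "U \<noteq> {}" for U
    proof -
      have "inverse (real (Suc n)) > 0" by simp
      from maxima_localise[OF K ne U this] obtain V x where "open V" "V \<noteq> {}" "V \<subseteq> U"
        "\<And>w. w \<in> V \<Longrightarrow> \<exists>a\<in>K. norm (a - x) \<le> inverse (real (Suc n)) \<and> (\<forall>k\<in>K. blinfun_apply w k \<le> w a)"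
        by metis
      then have "good V (inverse (real (Suc n)))" "V \<noteq> {}" "V \<subseteq> U" unfolding good_def by blast+
      then show ?thesis by (auto simp: G_def)
    qed
    from this[of "- closure (G n)"] show ?thesis using closure_subset[of "G n"] by auto
  qed
  ultimately have "euclidean closure_of \<Inter>(range G) = topspace euclidean"
    by (intro Baire_category) (auto simp: completely_metrizable_space_euclidean)
  then have "closure (\<Inter>(range G)) = UNIV" by simp
  then have "\<Inter>(range G) \<noteq> {}" by (metis closure_empty empty_not_UNIV)
  then obtain x' where x': "\<And>n. x' \<in> G n" by blast
  show thesis
  proof
    fix \<epsilon> :: real assume "\<epsilon> > 0"
    then obtain n where n: "inverse (real (Suc n)) < \<epsilon>" using reals_Archimedean by blast
    obtain V where V: "good V (inverse (real (Suc n)))" "x' \<in> V" using x'[of n] by (auto simp: G_def)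
    then obtain r where r: "r > 0" "ball x' r \<subseteq> V" unfolding good_def by (meson open_contains_ball)
    obtain x where x: "\<And>w. w \<in> V \<Longrightarrow> \<exists>a\<in>K. norm (a - x) \<le> inverse (real (Suc n)) \<and> (\<forall>k\<in>K. blinfun_apply w k \<le> w a)"
      using V(1) unfolding good_def by blast
    show "\<exists>x r. r > 0 \<and>
      (\<forall>w. norm (w - x') < r \<longrightarrow> (\<exists>a\<in>K. norm (a - x) \<le> \<epsilon> \<and> (\<forall>k\<in>K. blinfun_apply w k \<le> w a)))"
    proof (intro exI conjI allI impI)
      show "r > 0" by (rule r(1))
      fix w assume "norm (w - x') < r"
      then have "w \<in> V" using r(2) by (auto simp: dist_norm norm_minus_commute)
      with x n show "\<exists>a\<in>K. norm (a - x) \<le> \<epsilon> \<and> (\<forall>k\<in>K. blinfun_apply w k \<le> w a)"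
        by (meson less_imp_le order_trans)
    qed
  qed
qed

definition within_distance :: "real \<Rightarrow> 'a::real_normed_vector set \<Rightarrow> 'a set \<Rightarrow> bool" where
  "within_distance \<eta> A B \<longleftrightarrow>
    (\<forall>a\<in>A. \<exists>b\<in>B. norm (a - b) \<le> \<eta>) \<and> (\<forall>b\<in>B. \<exists>a\<in>A. norm (b - a) \<le> \<eta>)"

lemma within_distanceD:
  assumes "within_distance \<eta> A B"
  shows "a \<in> A \<Longrightarrow> \<exists>b\<in>B. norm (a - b) \<le> \<eta>" "b \<in> B \<Longrightarrow> \<exists>a\<in>A. norm (b - a) \<le> \<eta>"
  using assms by (auto simp: within_distance_def)

text \<open>
Strong exposedness, phrased for maximisers over sets close to \<open>K\<close> because Riemann sums only
approximate the integral. The case \<open>R = K\<close> says that \<open>x0\<close> is the only point at which \<open>x'\<close> can attain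
its maximum over \<open>K\<close>.
\<close>

definition stably_exposes :: "('a::real_normed_vector \<Rightarrow>\<^sub>L real) \<Rightarrow> 'a \<Rightarrow> 'a set \<Rightarrow> bool" where
  "stably_exposes x' x0 K \<longleftrightarrow>
    (\<forall>\<epsilon>>0. \<exists>\<eta>>0. \<forall>R y. within_distance \<eta> K R \<and> y \<in> R \<and> (\<forall>r\<in>R. x' r \<le> x' y) \<longrightarrow>
       norm (y - x0) \<le> \<epsilon>)"

lemma stably_exposesE:
  assumes "stably_exposes x' x0 K" "\<epsilon> > 0"
  obtains \<eta> where "\<eta> > 0" "\<And>R y. within_distance \<eta> K R \<Longrightarrow> y \<in> R \<Longrightarrow> (\<forall>r\<in>R. x' r \<le> x' y) \<Longrightarrow>
        norm (y - x0) \<le> \<epsilon>"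
proof -
  have "\<exists>\<eta>>0. \<forall>R y. within_distance \<eta> K R \<and> y \<in> R \<and> (\<forall>r\<in>R. x' r \<le> x' y) \<longrightarrow>
       norm (y - x0) \<le> \<epsilon>"
    using assms(1)[unfolded stably_exposes_def, THEN spec, THEN mp, OF assms(2)] .
  then obtain \<eta> where "\<eta> > 0" and near: "\<forall>R y. within_distance \<eta> K R \<and> y \<in> R \<and> (\<forall>r\<in>R. x' r \<le> x' y) \<longrightarrow>
       norm (y - x0) \<le> \<epsilon>" by (elim exE conjE)
  from \<open>\<eta> > 0\<close> show thesis
    by (rule that) (rule near[THEN spec, THEN spec, THEN mp], intro conjI)
qed

text \<open>
Let \<open>x'\<close> be generic and let \<open>y\<close> maximise \<open>x'\<close> over \<open>R\<close>. Tilt \<open>x'\<close> by a small multiple \<open>t\<close> of a functional \<open>h\<close>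
that norms \<open>y - x\<close>. The tilted functional attains its maximum over \<open>K\<close> at some \<open>a\<close> close to \<open>x\<close>. Since \<open>y\<close>
and \<open>a\<close> both nearly maximise the untilted functional, comparing the tilted values at \<open>y\<close> and \<open>a\<close> bounds
\<open>h y\<close> by \<open>h a\<close> up to an error of order \<open>\<eta> / t\<close>, and \<open>h (a - x)\<close> is small.
\<close>

theorem stably_exposed_point_exists:
  fixes K :: "'a::real_normed_vector set"
  assumes K: "weakly_compact K" and ne: "K \<noteq> {}"
  obtains x' x0 where "stably_exposes x' x0 K"
proof -
  obtain x' :: "'a \<Rightarrow>\<^sub>L real" where x': "\<And>\<epsilon>. \<epsilon> > 0 \<Longrightarrow> \<exists>x r. r > 0 \<and>
    (\<forall>w. norm (w - x') < r \<longrightarrow> (\<exists>a\<in>K. norm (a - x) \<le> \<epsilon> \<and> (\<forall>k\<in>K. blinfun_apply w k \<le> w a)))"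
    using generic_functional[OF K ne] by blast
  obtain x0 where x0: "x0 \<in> K" "\<And>k. k \<in> K \<Longrightarrow> x' k \<le> x' x0"
    using weakly_compact_attains_sup[OF K ne, of x'] by blast
  have estimate: "norm (y - x) \<le> \<epsilon> + \<eta> * (2 * norm x' + t) / t"
    if near: "\<And>w. norm (w - x') \<le> t \<Longrightarrow> \<exists>a\<in>K. norm (a - x) \<le> \<epsilon> \<and> (\<forall>k\<in>K. blinfun_apply w k \<le> w a)"
      and t: "t > 0" and \<eta>: "\<eta> \<ge> 0" and KR: "\<And>k. k \<in> K \<Longrightarrow> \<exists>r\<in>R. norm (k - r) \<le> \<eta>"
      and RK: "\<And>r. r \<in> R \<Longrightarrow> \<exists>k\<in>K. norm (r - k) \<le> \<eta>" and y: "y \<in> R" "\<And>r. r \<in> R \<Longrightarrow> x' r \<le> x' y"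
    for y x \<epsilon> \<eta> t R
  proof -
    obtain h :: "'a \<Rightarrow>\<^sub>L real" where h: "norm h \<le> 1" "h (y - x) = norm (y - x)"
      by (rule norming_functional)
    define w where "w = x' + t *\<^sub>R h"
    have "norm (w - x') \<le> t" using h(1) t by (simp add: w_def)
    then obtain a where a: "a \<in> K" "norm (a - x) \<le> \<epsilon>" "\<And>k. k \<in> K \<Longrightarrow> w k \<le> w a" using near by blast
    have w_norm: "norm w \<le> norm x' + t"
      using \<open>norm (w - x') \<le> t\<close> norm_triangle_sub[of w x'] by linarith
    obtain k where k: "k \<in> K" "norm (y - k) \<le> \<eta>" using RK[OF y(1)] by blast
    have "w y = w k + w (y - k)" by (simp add: blinfun.diff_right)
    also have "w (y - k) \<le> norm w * norm (y - k)" by (rule blinfun_le_norm)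
    also have "\<dots> \<le> (norm x' + t) * \<eta>" using w_norm k(2) t by (intro mult_mono) auto
    also have "w k \<le> w a" by (rule a(3)[OF k(1)])
    finally have 1: "w y \<le> w a + (norm x' + t) * \<eta>" by simp
    obtain r where r: "r \<in> R" "norm (x0 - r) \<le> \<eta>" using KR[OF x0(1)] by blast
    have "x' a \<le> x' x0" by (rule x0(2)[OF a(1)])
    also have "x' x0 = x' r + x' (x0 - r)" by (simp add: blinfun.diff_right)
    also have "x' (x0 - r) \<le> norm x' * norm (x0 - r)" by (rule blinfun_le_norm)
    also have "\<dots> \<le> norm x' * \<eta>" using r(2) by (intro mult_left_mono) auto
    also have "x' r \<le> x' y" by (rule y(2)[OF r(1)])
    finally have 2: "x' a \<le> x' y + norm x' * \<eta>" by simp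
    have "t * h y \<le> t * h a + \<eta> * (2 * norm x' + t)"
      using 1 2 by (simp add: w_def blinfun.add_left blinfun.scaleR_left algebra_simps)
    then have "h y \<le> h a + \<eta> * (2 * norm x' + t) / t"
      using t by (simp add: field_simps)
    moreover have "h (a - x) \<le> \<epsilon>"
    proof -
      have "h (a - x) \<le> norm h * norm (a - x)" by (rule blinfun_le_norm)
      also have "\<dots> \<le> 1 * \<epsilon>" using h(1) a(2) by (intro mult_mono) auto
      finally show ?thesis by simp
    qed
    ultimately show ?thesis using h(2) by (simp add: blinfun.diff_right)
  qed
  have "stably_exposes x' x0 K"
    unfolding stably_exposes_def
  proof (intro allI impI)
    fix \<epsilon> :: real assume \<epsilon>: "\<epsilon> > 0"
    then obtain x r where r: "r > 0"
      "\<And>w. norm (w - x') < r \<Longrightarrow> \<exists>a\<in>K. norm (a - x) \<le> \<epsilon> / 3 \<and> (\<forall>k\<in>K. blinfun_apply w k \<le> w a)"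
      using x'[of "\<epsilon> / 3"] by auto
    define t where "t = r / 2"
    have t: "t > 0" "\<And>w. norm (w - x') \<le> t \<Longrightarrow> \<exists>a\<in>K. norm (a - x) \<le> \<epsilon> / 3 \<and> (\<forall>k\<in>K. blinfun_apply w k \<le> w a)"
      using r by (auto simp: t_def)
    define P where "P = 2 * norm x' + t"
    define \<eta> where "\<eta> = \<epsilon> / 3 * t / P"
    have "P > 0" using t(1) by (simp add: P_def add_nonneg_pos)
    then have "\<eta> > 0" "\<eta> * P / t = \<epsilon> / 3"
      using \<epsilon> t(1) by (auto simp: \<eta>_def)
    then have \<eta>: "\<eta> > 0" "\<eta> * (2 * norm x' + t) / t = \<epsilon> / 3"
      unfolding P_def by simp_all
    (* The estimate with R = K and \<eta> = 0 shows that x0 is close to the centre x. *)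
    have "norm (x0 - x) \<le> \<epsilon> / 3 + 0 * (2 * norm x' + t) / t"
      by (rule estimate[OF t(2) t(1), where R = K]) (use x0 in \<open>auto intro: bexI[of _ "_ :: 'a"]\<close>)
    then have x0x: "norm (x0 - x) \<le> \<epsilon> / 3" by simp
    show "\<exists>\<eta>>0. \<forall>R y. within_distance \<eta> K R \<and> y \<in> R \<and> (\<forall>r\<in>R. x' r \<le> x' y) \<longrightarrow>
       norm (y - x0) \<le> \<epsilon>"
    proof (intro exI[of _ \<eta>] conjI allI impI; (elim conjE)?)
      show "\<eta> > 0" by (rule \<eta>(1))
      fix R y assume KR: "within_distance \<eta> K R" and y: "y \<in> R" "\<forall>r\<in>R. x' r \<le> x' y"
      have "norm (y - x) \<le> \<epsilon> / 3 + \<eta> * (2 * norm x' + t) / t"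
        using estimate[OF t(2) t(1), where R = R and \<eta> = \<eta> and y = y] \<eta>(1)
          within_distanceD[OF KR] y by auto
      then have "norm (y - x) \<le> \<epsilon> / 3 + \<epsilon> / 3" by (simp only: \<eta>(2))
      moreover have "norm (y - x0) \<le> norm (y - x) + norm (x0 - x)"
        using norm_triangle_ineq4[of "y - x" "x0 - x"] by simp
      ultimately show "norm (y - x0) \<le> \<epsilon>" using x0x by linarith
    qed
  qed
  then show thesis by (rule that)
qed


section \<open>Riemann sums of multifunctions\<close>

lemma hausdorff_dist_less_imp_near:
  assumes less: "hausdorff_dist A B < ennreal \<epsilon>" and ne: "B \<noteq> {}" and a: "a \<in> A"
  shows "\<exists>b\<in>B. dist a b < \<epsilon>"
proof -
  have "ennreal (infdist a B) \<le> hausdorff_dist A B"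
    unfolding hausdorff_dist_def using a by (intro max.coboundedI1 SUP_upper)
  then have "ennreal (infdist a B) < ennreal \<epsilon>" using less by (rule order_le_less_trans)
  then have "infdist a B < \<epsilon>" by (simp add: ennreal_less_iff infdist_nonneg)
  then have "(INF b\<in>B. dist a b) < \<epsilon>" using ne by (simp add: infdist_def)
  moreover have "bdd_below (dist a ` B)" by (intro bdd_belowI[of _ 0]) auto
  ultimately show ?thesis using ne by (simp add: cINF_less_iff)
qed

lemma hausdorff_dist_less_imp_within_distance:
  assumes ne: "B \<noteq> {}" "A \<noteq> {}" and less: "hausdorff_dist A B < ennreal \<epsilon>"
  shows "within_distance \<epsilon> A B"
proof -
  have less': "hausdorff_dist B A < ennreal \<epsilon>"
    using less by (simp add: hausdorff_dist_def max.commute)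
  show ?thesis
    using hausdorff_dist_less_imp_near[OF less ne(1)] hausdorff_dist_less_imp_near[OF less' ne(2)]
    unfolding within_distance_def dist_norm by (meson less_imp_le)
qed

definition riemann_point :: "(real \<Rightarrow> 'a::real_normed_vector) \<Rightarrow> (real \<times> real set) set \<Rightarrow> 'a" where
  "riemann_point f p = (\<Sum>(t, I)\<in>p. measure lborel I *\<^sub>R f t)"

lemma riemann_point_in_riemann_sum:
  assumes "finite p" "\<And>t I. (t, I) \<in> p \<Longrightarrow> f t \<in> \<Gamma> t"
  shows "riemann_point f p \<in> riemann_sum \<Gamma> p"
  using assms unfolding riemann_point_def riemann_sum_def
proof (induction p rule: finite_induct)
  case (insert x p)
  then show ?case by (cases x) (auto intro!: set_plus_intro)
qed simp

lemma riemann_sum_bidual_closed: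
  assumes "finite p" "\<And>t I. (t, I) \<in> p \<Longrightarrow> bidual_closed (\<Gamma> t)"
  shows "bidual_closed (riemann_sum \<Gamma> p) \<and>
    support x' (riemann_sum \<Gamma> p) = riemann_point (\<lambda>t. support x' (\<Gamma> t)) p"
  using assms unfolding riemann_point_def riemann_sum_def
proof (induction p rule: finite_induct)
  case empty
  have "(0 :: 'a set) = {0}" by (simp add: set_zero)
  then show ?case using bidual_closed_singleton[of 0] by (simp add: support_def)
next
  case (insert x p)
  obtain t I where x: "x = (t, I)" by (cases x)
  have 1: "bidual_closed (\<Gamma> t)" using insert.prems x by blast
  have 2: "bidual_closed (\<Sum>(t, I)\<in>p. (\<lambda>x. measure lborel I *\<^sub>R x) ` \<Gamma> t)"
    "support x' (\<Sum>(t, I)\<in>p. (\<lambda>x. measure lborel I *\<^sub>R x) ` \<Gamma> t) =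
      (\<Sum>(t, I)\<in>p. measure lborel I *\<^sub>R support x' (\<Gamma> t))"
    using insert by blast+
  have 3: "bidual_closed ((\<lambda>x. measure lborel I *\<^sub>R x) ` \<Gamma> t)"
    by (rule bidual_closed_scaleR[OF 1]) simp
  show ?case
    using insert.hyps bidual_closed_plus[OF 3 2(1)] support_plus[OF 3 2(1), of x']
    by (simp add: x 2(2) support_scaleR[OF 1])
qed

lemma tagged_partition_finite: "tagged_partition p \<Longrightarrow> finite p"
  by (simp add: tagged_partition_def)

lemma tagged_partition_tag: "tagged_partition p \<Longrightarrow> (t, I) \<in> p \<Longrightarrow> t \<in> {0..1}"
  by (auto simp: tagged_partition_def)

lemma fine_gauge_of_delta:
  assumes \<delta>: "\<forall>t\<in>{0..1}. \<delta> t > (0::real)"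
  obtains \<gamma> where "gauge \<gamma>"
    "\<And>p. p tagged_division_of {0..1} \<Longrightarrow> \<gamma> fine p \<Longrightarrow> perron_partition p \<and> delta_fine \<delta> p"
proof
  define \<gamma> where "\<gamma> t = (if t \<in> {0..1} then {t - \<delta> t<..<t + \<delta> t} else UNIV)" for t
  show "gauge \<gamma>" using \<delta> by (auto simp: gauge_def \<gamma>_def)
  fix p assume p: "p tagged_division_of {0..1}" "\<gamma> fine p"
  have pp: "perron_partition p" using p(1) by (simp add: perron_partition_iff_tagged_division)
  have "I \<subseteq> {t - \<delta> t<..<t + \<delta> t}" if tI: "(t, I) \<in> p" for t I
  proof -
    have "t \<in> {0..1}" using tI pp tagged_partition_tag by (auto simp: perron_partition_def)
    then have "\<gamma> t = {t - \<delta> t<..<t + \<delta> t}" by (simp add: \<gamma>_def)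
    then show ?thesis using fineD[OF p(2) tI] by simp
  qed
  then show "perron_partition p \<and> delta_fine \<delta> p" using pp by (auto simp: delta_fine_def)
qed

lemma delta_fine_perron_partition_exists:
  assumes "\<forall>t\<in>{0..1}. \<delta> t > (0::real)"
  obtains p where "perron_partition p" "delta_fine \<delta> p"
proof -
  obtain \<gamma> where \<gamma>: "gauge \<gamma>"
    "\<And>p. p tagged_division_of {0..1} \<Longrightarrow> \<gamma> fine p \<Longrightarrow> perron_partition p \<and> delta_fine \<delta> p"
    by (rule fine_gauge_of_delta[OF assms]) (rule that)
  obtain p where "p tagged_division_of {0..1}" "\<gamma> fine p"
    using fine_division_exists_real[OF \<gamma>(1)] by blast
  then show thesis using \<gamma>(2) that by blast
qed

lemma perron_le_tagged: "perron_partition \<le> tagged_partition"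
  by (auto simp: perron_partition_def)

text \<open>
The Henstock integral is the case of Perron partitions and the McShane integral the case of all tagged
partitions.
\<close>

definition integral_over ::
  "((real \<times> real set) set \<Rightarrow> bool) \<Rightarrow> (real \<Rightarrow> 'a::real_normed_vector set) \<Rightarrow> 'a set \<Rightarrow> bool" where
  "integral_over P \<Gamma> \<Phi> \<longleftrightarrow> \<Phi> \<noteq> {} \<and> closed \<Phi> \<and> convex \<Phi> \<and>
     (\<forall>\<epsilon>>0. \<exists>\<delta>. (\<forall>t\<in>{0..1}. \<delta> t > 0) \<and>
        (\<forall>p. P p \<and> delta_fine \<delta> p \<longrightarrow> hausdorff_dist \<Phi> (riemann_sum \<Gamma> p) < ennreal \<epsilon>))"

lemma has_henstock_integral_multi_iff: "has_henstock_integral_multi = integral_over perron_partition"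
  by (simp add: fun_eq_iff has_henstock_integral_multi_def integral_over_def)

lemma has_mcshane_integral_multi_iff: "has_mcshane_integral_multi = integral_over tagged_partition"
  by (simp add: fun_eq_iff has_mcshane_integral_multi_def integral_over_def)

lemma integral_over_singleton_iff:
  assumes "P \<le> tagged_partition"
  shows "integral_over P (\<lambda>t. {f t}) {v} \<longleftrightarrow>
    (\<forall>\<epsilon>>0. \<exists>\<delta>. (\<forall>t\<in>{0..1}. \<delta> t > 0) \<and>
        (\<forall>p. P p \<and> delta_fine \<delta> p \<longrightarrow> norm (v - riemann_point f p) < \<epsilon>))"
  using tagged_partition_finite[OF predicate1D[OF assms]] unfolding integral_over_def riemann_point_def
  by (simp add: riemann_sum_singleton hausdorff_dist_singleton dist_norm ennreal_less_iff
      cong: conj_cong imp_cong)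

lemma integral_over_mono:
  assumes "Q \<le> P" "integral_over P \<Gamma> \<Phi>"
  shows "integral_over Q \<Gamma> \<Phi>"
  using assms(2) predicate1D[OF assms(1)] unfolding integral_over_def by meson

lemma integral_over_perron_imp_has_integral:
  fixes f :: "real \<Rightarrow> 'a::real_normed_vector"
  assumes f: "integral_over perron_partition (\<lambda>t. {f t}) {v}"
  shows "(f has_integral v) {0..1}"
proof -
  have "(f has_integral v) (cbox 0 1)"
    unfolding has_integral
  proof (intro allI impI)
    fix \<epsilon> :: real assume "\<epsilon> > 0"
    note f[unfolded integral_over_singleton_iff[OF perron_le_tagged], rule_format, OF this]
    then obtain \<delta> where \<delta>: "\<forall>t\<in>{0..1}. \<delta> t > (0::real)"
      "\<And>p. perron_partition p \<Longrightarrow> delta_fine \<delta> p \<Longrightarrow> norm (v - riemann_point f p) < \<epsilon>"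
      by blast
    obtain \<gamma> where \<gamma>: "gauge \<gamma>"
      "\<And>p. p tagged_division_of {0..1} \<Longrightarrow> \<gamma> fine p \<Longrightarrow> perron_partition p \<and> delta_fine \<delta> p"
      by (rule fine_gauge_of_delta[OF \<delta>(1)]) (rule that)
    have "norm ((\<Sum>(x, k)\<in>p. measure lborel k *\<^sub>R f x) - v) < \<epsilon>"
      if p: "p tagged_division_of cbox 0 1" "\<gamma> fine p" for p
      using \<gamma>(2)[of p] \<delta>(2)[of p] p by (simp add: riemann_point_def norm_minus_commute)
    then show "\<exists>\<gamma>. gauge \<gamma> \<and> (\<forall>p. p tagged_division_of cbox 0 1 \<and> \<gamma> fine p \<longrightarrow>
        norm ((\<Sum>(x, k)\<in>p. measure lborel k *\<^sub>R f x) - v) < \<epsilon>)"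
      by (intro exI[of _ \<gamma>]) (simp add: \<gamma>(1))
  qed
  then show ?thesis by simp
qed

section \<open>Selections of an integrable multifunction\<close>

context
  fixes P :: "(real \<times> real set) set \<Rightarrow> bool"
    and \<Gamma> :: "real \<Rightarrow> 'a::banach set" and \<Phi> :: "'a set"
  assumes P_tagged: "P \<le> tagged_partition"
    and perron_P: "perron_partition \<le> P"
    and \<Gamma>: "\<And>t. t \<in> {0..1} \<Longrightarrow> \<Gamma> t \<in> cwk"
    and \<Phi>: "integral_over P \<Gamma> \<Phi>"
begin

lemma values_weakly_compact:
  assumes "t \<in> {0..1}"
  shows "\<Gamma> t \<noteq> {}" "weakly_compact (\<Gamma> t)" "bidual_closed (\<Gamma> t)"
proof -
  show "\<Gamma> t \<noteq> {}" "weakly_compact (\<Gamma> t)"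
    using \<Gamma>[OF assms] cwk_imp_weakly_compact by (auto simp: cwk_def)
  then show "bidual_closed (\<Gamma> t)"
    using \<Gamma>[OF assms] by (intro convex_weakly_compact_imp_bidual_closed) (auto simp: cwk_def)
qed

lemma partition_riemann_sum:
  assumes "P p"
  shows "bidual_closed (riemann_sum \<Gamma> p)"
    "support x' (riemann_sum \<Gamma> p) = riemann_point (\<lambda>t. support x' (\<Gamma> t)) p"
  using riemann_sum_bidual_closed[of p \<Gamma>] tagged_partition_finite[OF predicate1D[OF P_tagged assms]]
    tagged_partition_tag[OF predicate1D[OF P_tagged assms]] values_weakly_compact(3) by blast+

lemma riemann_sums_within_distance:
  assumes "\<epsilon> > 0"
  obtains \<delta> where "\<forall>t\<in>{0..1}. \<delta> t > (0::real)"
    "\<And>p. P p \<Longrightarrow> delta_fine \<delta> p \<Longrightarrow> within_distance \<epsilon> \<Phi> (riemann_sum \<Gamma> p)"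
proof -
  obtain \<delta> where \<delta>: "\<forall>t\<in>{0..1}. \<delta> t > 0"
    "\<And>p. P p \<Longrightarrow> delta_fine \<delta> p \<Longrightarrow> hausdorff_dist \<Phi> (riemann_sum \<Gamma> p) < ennreal \<epsilon>"
    using \<Phi> assms unfolding integral_over_def by blast
  show thesis
  proof
    show "\<forall>t\<in>{0..1}. \<delta> t > 0" by (rule \<delta>(1))
    fix p assume p: "P p" "delta_fine \<delta> p"
    have "riemann_sum \<Gamma> p \<noteq> {}" "\<Phi> \<noteq> {}"
      using bidual_closed_nonempty[OF partition_riemann_sum(1)[OF p(1)]] \<Phi>
      by (simp_all add: integral_over_def)
    then show "within_distance \<epsilon> \<Phi> (riemann_sum \<Gamma> p)"
      using \<delta>(2)[OF p] by (rule hausdorff_dist_less_imp_within_distance)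
  qed
qed

text \<open>
The Riemann sums have the property and approximate \<open>\<Phi>\<close>; that arbitrarily fine ones exist is Cousin's
lemma.
\<close>

lemma integral_bidual_closed: "bidual_closed \<Phi>"
proof (rule bidual_closed_limit)
  show "\<Phi> \<noteq> {}" "closed \<Phi>" "convex \<Phi>" using \<Phi> by (auto simp: integral_over_def)
  fix \<epsilon> :: real assume "\<epsilon> > 0"
  obtain \<delta> where \<delta>: "\<forall>t\<in>{0..1}. \<delta> t > (0::real)"
    "\<And>p. P p \<Longrightarrow> delta_fine \<delta> p \<Longrightarrow> within_distance \<epsilon> \<Phi> (riemann_sum \<Gamma> p)"
    by (rule riemann_sums_within_distance[OF \<open>\<epsilon> > 0\<close>]) (rule that)
  obtain p where p: "perron_partition p" "delta_fine \<delta> p"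
    using delta_fine_perron_partition_exists[OF \<delta>(1)] by blast
  show "\<exists>R. bidual_closed R \<and> (\<forall>a\<in>\<Phi>. \<exists>r\<in>R. norm (a - r) \<le> \<epsilon>)"
    using partition_riemann_sum(1)[OF predicate1D[OF perron_P p(1)]] within_distanceD(1)[OF \<delta>(2)[OF predicate1D[OF perron_P p(1)] p(2)]] by blast
qed

text \<open>
Support functions turn Minkowski sums into sums and Hausdorff distance into distance of values.
\<close>

lemma support_has_integral:
  "((\<lambda>t. support x' (\<Gamma> t)) has_integral support x' \<Phi>) {0..1}"
proof (rule integral_over_perron_imp_has_integral)
  have support_le_near: "support x' A \<le> support x' B + norm x' * \<epsilon>"
    if A: "A \<noteq> {}" and B: "bidual_closed B" and near: "\<And>a. a \<in> A \<Longrightarrow> \<exists>b\<in>B. norm (a - b) \<le> \<epsilon>" for A B \<epsilon>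
  proof (rule support_le[OF A])
    fix a assume "a \<in> A"
    then obtain b where b: "b \<in> B" "norm (a - b) \<le> \<epsilon>" using near by blast
    have "x' a = x' b + x' (a - b)" by (simp add: blinfun.diff_right)
    also have "x' b \<le> support x' B" by (rule support_ge[OF bidual_closed_bdd[OF B] b(1)])
    also have "x' (a - b) \<le> norm x' * norm (a - b)" by (rule blinfun_le_norm)
    also have "\<dots> \<le> norm x' * \<epsilon>" using b(2) by (intro mult_left_mono) auto
    finally show "x' a \<le> support x' B + norm x' * \<epsilon>" by simp
  qed
  have converges: "\<exists>\<delta>. (\<forall>t\<in>{0..1}. \<delta> t > 0) \<and> (\<forall>p. perron_partition p \<and> delta_fine \<delta> p \<longrightarrow>
      norm (support x' \<Phi> - riemann_point (\<lambda>t. support x' (\<Gamma> t)) p) < \<epsilon>)" if \<epsilon>: "\<epsilon> > 0" for \<epsilon>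
  proof -
    define \<eta> where "\<eta> = \<epsilon> / (norm x' + 1)"
    have pos: "norm x' + 1 > 0" by (simp add: add_nonneg_pos)
    then have \<eta>: "\<eta> > 0" using \<epsilon> by (simp add: \<eta>_def)
    have "\<epsilon> = \<eta> * (norm x' + 1)" using pos by (simp add: \<eta>_def)
    then have \<eta>\<epsilon>: "norm x' * \<eta> < \<epsilon>" using \<eta> by (simp add: algebra_simps)
    obtain \<delta> where \<delta>: "\<forall>t\<in>{0..1}. \<delta> t > (0::real)"
      "\<And>p. P p \<Longrightarrow> delta_fine \<delta> p \<Longrightarrow> within_distance \<eta> \<Phi> (riemann_sum \<Gamma> p)"
      by (rule riemann_sums_within_distance[OF \<eta>]) (rule that)
    have "norm (support x' \<Phi> - riemann_point (\<lambda>t. support x' (\<Gamma> t)) p) < \<epsilon>"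
      if p: "perron_partition p" "delta_fine \<delta> p" for p
    proof -
      note Pp = predicate1D[OF perron_P p(1)] and R = partition_riemann_sum[OF predicate1D[OF perron_P p(1)]]
      have "support x' \<Phi> \<le> support x' (riemann_sum \<Gamma> p) + norm x' * \<eta>"
        using bidual_closed_nonempty[OF integral_bidual_closed] R(1) within_distanceD(1)[OF \<delta>(2)[OF Pp p(2)]]
        by (rule support_le_near)
      moreover have "support x' (riemann_sum \<Gamma> p) \<le> support x' \<Phi> + norm x' * \<eta>"
        using bidual_closed_nonempty[OF R(1)] integral_bidual_closed within_distanceD(2)[OF \<delta>(2)[OF Pp p(2)]]
        by (rule support_le_near)
      ultimately show ?thesis using \<eta>\<epsilon> R(2)[of x'] by simp
    qed
    then show ?thesis using \<delta>(1) by blast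
  qed
  show "integral_over perron_partition (\<lambda>t. {support x' (\<Gamma> t)}) {support x' \<Phi>}"
    by (rule integral_over_singleton_iff[OF perron_le_tagged, THEN iffD2])
      (intro allI impI converges)
qed

text \<open>
Maximising a fixed functional commutes with forming Riemann sums: the Riemann sum of pointwise
maximisers is a maximiser over the Riemann sum. For a functional that stably exposes a point of \<open>\<Phi>\<close> this
forces convergence to that point.
\<close>

theorem integrable_selection_exists:
  obtains f x0 where "selection_of f \<Gamma>" "integral_over P (\<lambda>t. {f t}) {x0}"
proof -
  obtain x' x0 where exposed: "stably_exposes x' x0 \<Phi>"
    by (rule stably_exposed_point_exists[OF bidual_closed_imp_weakly_compact[OF integral_bidual_closed]
        bidual_closed_nonempty[OF integral_bidual_closed]])
  have "\<forall>t\<in>{0..1}. \<exists>a. a \<in> \<Gamma> t \<and> (\<forall>b\<in>\<Gamma> t. x' b \<le> x' a)"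
  proof
    fix t :: real assume "t \<in> {0..1}"
    from weakly_compact_attains_sup[OF values_weakly_compact(2)[OF this] values_weakly_compact(1)[OF this], of x']
    show "\<exists>a. a \<in> \<Gamma> t \<and> (\<forall>b\<in>\<Gamma> t. x' b \<le> x' a)" by blast
  qed
  from bchoice[OF this] obtain f where f: "\<And>t. t \<in> {0..1} \<Longrightarrow> f t \<in> \<Gamma> t"
    "\<And>t b. t \<in> {0..1} \<Longrightarrow> b \<in> \<Gamma> t \<Longrightarrow> x' b \<le> x' (f t)" by blast
  have converges: "\<exists>\<delta>. (\<forall>t\<in>{0..1}. \<delta> t > 0) \<and> (\<forall>p. P p \<and> delta_fine \<delta> p \<longrightarrow> norm (x0 - riemann_point f p) < \<epsilon>)"
    if \<epsilon>: "\<epsilon> > 0" for \<epsilon>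
  proof -
    have "\<epsilon> / 2 > 0" using \<epsilon> by simp
    obtain \<eta> where \<eta>: "\<eta> > 0"
      and near: "\<And>R y. within_distance \<eta> \<Phi> R \<Longrightarrow> y \<in> R \<Longrightarrow> (\<forall>r\<in>R. x' r \<le> x' y) \<Longrightarrow>
        norm (y - x0) \<le> \<epsilon> / 2"
      by (rule stably_exposesE[OF exposed \<open>\<epsilon> / 2 > 0\<close>]) (rule that)
    obtain \<delta> where \<delta>: "\<forall>t\<in>{0..1}. \<delta> t > (0::real)"
      "\<And>p. P p \<Longrightarrow> delta_fine \<delta> p \<Longrightarrow> within_distance \<eta> \<Phi> (riemann_sum \<Gamma> p)"
      by (rule riemann_sums_within_distance[OF \<eta>]) (rule that)
    have "norm (x0 - riemann_point f p) < \<epsilon>" if p: "P p" "delta_fine \<delta> p" for p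
    proof -
      note fin = tagged_partition_finite[OF predicate1D[OF P_tagged p(1)]]
        and tag = tagged_partition_tag[OF predicate1D[OF P_tagged p(1)]]
        and R = partition_riemann_sum[OF p(1)]
      have x'f: "x' (f t) = support x' (\<Gamma> t)" if "t \<in> {0..1}" for t
        by (rule support_eq_max[symmetric, OF f(1)[OF that] f(2)[OF that]])
      have "x' (riemann_point f p) = riemann_point (\<lambda>t. support x' (\<Gamma> t)) p"
        unfolding riemann_point_def blinfun.sum_right
      proof (rule sum.cong)
        fix z assume "z \<in> p"
        then have "fst z \<in> {0..1}" using tag[of "fst z" "snd z"] by simp
        then show "x' (case z of (t, I) \<Rightarrow> measure lborel I *\<^sub>R f t) =
            (case z of (t, I) \<Rightarrow> measure lborel I *\<^sub>R support x' (\<Gamma> t))"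
          using x'f[of "fst z"] by (simp add: case_prod_unfold blinfun.scaleR_right)
      qed simp
      then have top: "x' r \<le> x' (riemann_point f p)" if "r \<in> riemann_sum \<Gamma> p" for r
        using support_ge[OF bidual_closed_bdd[OF R(1)] that, of x'] R(2)[of x'] by simp
      have "norm (riemann_point f p - x0) \<le> \<epsilon> / 2"
      proof (rule near)
        show "within_distance \<eta> \<Phi> (riemann_sum \<Gamma> p)" by (rule \<delta>(2)[OF p])
        show "riemann_point f p \<in> riemann_sum \<Gamma> p"
          by (rule riemann_point_in_riemann_sum[OF fin f(1)[OF tag]])
        show "\<forall>r\<in>riemann_sum \<Gamma> p. x' r \<le> x' (riemann_point f p)" using top by blast
      qed
      then show ?thesis using \<epsilon> by (simp add: norm_minus_commute)
    qed
    then show ?thesis using \<delta>(1) by blast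
  qed
  have "integral_over P (\<lambda>t. {f t}) {x0}"
    by (rule integral_over_singleton_iff[OF P_tagged, THEN iffD2]) (intro allI impI converges)
  moreover have "selection_of f \<Gamma>" using f(1) by (simp add: selection_of_def)
  ultimately show thesis by (intro that)
qed

text \<open>
The nonnegative \<open>gap\<close> function dominates \<open>x' (g - f)\<close>. Its nonnegativity is used twice: it upgrades
Henstock-Kurzweil to Lebesgue integrability, and it lets the integral over \<open>E\<close> be bounded by the one
over the whole interval, so that the single set \<open>\<Phi>\<close> represents the integrals over all measurable sets.
\<close>

theorem difference_of_selections_pettis:
  assumes f: "selection_of f \<Gamma>" "(f has_integral x0) {0..1}"
    and g: "selection_of g \<Gamma>" "scalarly_measurable g"
  shows "pettis_integrable (\<lambda>t. g t - f t)"
proof -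
  let ?M = "lebesgue_on {0..1::real}"
  define h where "h t = g t - f t" for t
  define gap where "gap x' t = support x' (\<Gamma> t) - blinfun_apply x' (f t)" for x' t
  have gap_integral: "(gap x' has_integral (support x' \<Phi> - x' x0)) {0..1}" for x'
    unfolding gap_def
    using has_integral_diff[OF support_has_integral[of x']
        has_integral_linear[OF f(2) blinfun.bounded_linear_right[of x']]]
    by (simp add: o_def)
  have le_support: "blinfun_apply x' (k t) \<le> support x' (\<Gamma> t)" if "selection_of k \<Gamma>" "t \<in> {0..1}" for x' k t
    using that support_ge[OF bidual_closed_bdd[OF values_weakly_compact(3)]]
    by (simp add: selection_of_def)
  have gap_nonneg: "gap x' t \<ge> 0" and h_le_gap: "blinfun_apply x' (h t) \<le> gap x' t" if "t \<in> {0..1}" for x' t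
    using le_support[OF f(1) that, of x'] le_support[OF g(1) that, of x']
    by (simp_all add: gap_def h_def blinfun.diff_right)
  have gap_int: "integrable ?M (gap x')" "(LINT t|?M. gap x' t) = support x' \<Phi> - x' x0" for x'
  proof -
    have "gap x' absolutely_integrable_on {0..1}"
      using gap_integral gap_nonneg by (intro nonnegative_absolutely_integrable_1) auto
    then show int: "integrable ?M (gap x')"
      by (simp add: integrable_restrict_space set_integrable_def)
    show "(LINT t|?M. gap x' t) = support x' \<Phi> - x' x0"
      using has_integral_integral_lebesgue_on[OF int] gap_integral by (simp add: has_integral_unique)
  qed
  have h_int: "integrable ?M (\<lambda>t. x' (h t))" for x' :: "'a \<Rightarrow>\<^sub>L real"
  proof (rule Bochner_Integration.integrable_bound)
    show "integrable ?M (\<lambda>t. gap x' t + gap (- x') t)" using gap_int(1) by simp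
    have "(\<lambda>t. x' (f t)) integrable_on {0..1}"
      using has_integral_linear[OF f(2) blinfun.bounded_linear_right[of x']]
      by (auto simp: o_def integrable_on_def)
    then have "(\<lambda>t. x' (f t)) \<in> borel_measurable ?M" by (rule integrable_imp_measurable)
    moreover have "(\<lambda>t. x' (g t)) \<in> borel_measurable ?M"
      using g(2) by (simp add: scalarly_measurable_def)
    ultimately show "(\<lambda>t. x' (h t)) \<in> borel_measurable ?M"
      by (simp add: h_def blinfun.diff_right)
    show "AE t in ?M. norm (x' (h t)) \<le> norm (gap x' t + gap (- x') t)"
    proof (rule AE_I2)
      fix t assume "t \<in> space ?M"
      then have t: "t \<in> {0..1}" by simp
      from h_le_gap[OF t, of x'] h_le_gap[OF t, of "- x'"] gap_nonneg[OF t, of x'] gap_nonneg[OF t, of "- x'"]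
      show "norm (x' (h t)) \<le> norm (gap x' t + gap (- x') t)" by (simp add: blinfun.minus_left)
    qed
  qed
  have "\<exists>v. \<forall>x' :: 'a \<Rightarrow>\<^sub>L real. x' v = (LINT t:E|?M. x' (h t))" if E: "E \<in> sets ?M" for E
  proof -
    (* Adding x' x0 moves the bound from the translate of \<Phi> by - x0 to \<Phi> itself. *)
    define l where "l x' = (LINT t:E|?M. x' (h t)) + x' x0" for x' :: "'a \<Rightarrow>\<^sub>L real"
    have set_int: "set_integrable ?M E k" if "integrable ?M k" for k :: "real \<Rightarrow> real"
      unfolding set_integrable_def using integrable_mult_indicator[OF E that] .
    have "linear l"
    proof (rule linearI)
      show "l (x' + y') = l x' + l y'" for x' y'
        by (simp add: l_def blinfun.add_left set_int h_int)
      show "l (c *\<^sub>R x') = c *\<^sub>R l x'" for c x'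
        by (simp add: l_def blinfun.scaleR_left distrib_left)
    qed
    moreover have "l x' \<le> support x' \<Phi>" for x'
    proof -
      have "(LINT t:E|?M. x' (h t)) \<le> (LINT t|?M. gap x' t)"
        unfolding set_lebesgue_integral_def
      proof (rule integral_mono)
        show "integrable ?M (\<lambda>t. indicator E t *\<^sub>R x' (h t))"
          using integrable_mult_indicator[OF E h_int] .
        show "integrable ?M (gap x')" by (rule gap_int)
        show "indicator E t *\<^sub>R x' (h t) \<le> gap x' t" if "t \<in> space ?M" for t
          using that h_le_gap[of t x'] gap_nonneg[of t x'] by (simp add: indicator_def)
      qed
      then show ?thesis by (simp add: l_def gap_int(2))
    qed
    ultimately obtain a where a: "l = evaluation a"
      using bidual_closed_represent[OF integral_bidual_closed] by blast
    have "x' (a - x0) = (LINT t:E|?M. x' (h t))" for x' :: "'a \<Rightarrow>\<^sub>L real"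
      using fun_cong[OF a, of x'] by (simp add: l_def blinfun.diff_right)
    then show ?thesis by blast
  qed
  then show ?thesis using h_int unfolding pettis_integrable_def h_def by blast
qed

end

section \<open>Integrability of scalarly measurable selections\<close>

lemma henstock_integrable_add:
  assumes "henstock_integrable f" "henstock_integrable g"
  shows "henstock_integrable (\<lambda>t. f t + g t)"
  using assms unfolding henstock_integrable_iff_integrable_on by (rule integrable_add)

lemma mcshane_integrable_add:
  assumes f: "mcshane_integrable f" and g: "mcshane_integrable g"
  shows "mcshane_integrable (\<lambda>t. f t + g t)"
proof -
  have iff: "mcshane_integrable k \<longleftrightarrow>
     (\<exists>v. \<forall>\<epsilon>>0. \<exists>\<delta>. (\<forall>t\<in>{0..1}. \<delta> t > 0) \<and>
        (\<forall>p. tagged_partition p \<and> delta_fine \<delta> p \<longrightarrow> norm (v - riemann_point k p) < \<epsilon>))" for k :: "real \<Rightarrow> 'a"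
    unfolding mcshane_integrable_iff riemann_point_def ..
  obtain v where v: "\<And>\<epsilon>. \<epsilon> > 0 \<Longrightarrow> \<exists>\<delta>. (\<forall>t\<in>{0..1}. \<delta> t > 0) \<and>
        (\<forall>p. tagged_partition p \<and> delta_fine \<delta> p \<longrightarrow> norm (v - riemann_point f p) < \<epsilon>)"
    using f unfolding iff by blast
  obtain w where w: "\<And>\<epsilon>. \<epsilon> > 0 \<Longrightarrow> \<exists>\<delta>. (\<forall>t\<in>{0..1}. \<delta> t > 0) \<and>
        (\<forall>p. tagged_partition p \<and> delta_fine \<delta> p \<longrightarrow> norm (w - riemann_point g p) < \<epsilon>)"
    using g unfolding iff by blast
  show ?thesis
    unfolding iff
  proof (intro exI[of _ "v + w"] allI impI)
    fix \<epsilon> :: real assume "\<epsilon> > 0"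
    then have "\<epsilon> / 2 > 0" by simp
    obtain \<delta>1 where \<delta>1: "\<forall>t\<in>{0..1}. \<delta>1 t > 0"
      "\<And>p. tagged_partition p \<Longrightarrow> delta_fine \<delta>1 p \<Longrightarrow> norm (v - riemann_point f p) < \<epsilon> / 2"
      using v[OF \<open>\<epsilon> / 2 > 0\<close>] by blast
    obtain \<delta>2 where \<delta>2: "\<forall>t\<in>{0..1}. \<delta>2 t > 0"
      "\<And>p. tagged_partition p \<Longrightarrow> delta_fine \<delta>2 p \<Longrightarrow> norm (w - riemann_point g p) < \<epsilon> / 2"
      using w[OF \<open>\<epsilon> / 2 > 0\<close>] by blast
    define \<delta> where "\<delta> t = min (\<delta>1 t) (\<delta>2 t)" for t
    have "norm (v + w - riemann_point (\<lambda>t. f t + g t) p) < \<epsilon>"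
      if p: "tagged_partition p" "delta_fine \<delta> p" for p
    proof -
      have "delta_fine \<delta>1 p" "delta_fine \<delta>2 p"
        using p(2) by (fastforce simp: delta_fine_def \<delta>_def)+
      then have "norm (v - riemann_point f p) < \<epsilon> / 2" "norm (w - riemann_point g p) < \<epsilon> / 2"
        using \<delta>1(2) \<delta>2(2) p(1) by blast+
      moreover have eq: "v + w - riemann_point (\<lambda>t. f t + g t) p =
          (v - riemann_point f p) + (w - riemann_point g p)"
        by (simp add: riemann_point_def scaleR_add_right sum.distrib case_prod_unfold)
      ultimately show ?thesis
        unfolding eq
        using norm_triangle_ineq[of "v - riemann_point f p" "w - riemann_point g p"] by linarith
    qed
    moreover have "\<forall>t\<in>{0..1}. \<delta> t > 0" using \<delta>1(1) \<delta>2(1) by (simp add: \<delta>_def)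
    ultimately show "\<exists>\<delta>. (\<forall>t\<in>{0..1}. \<delta> t > 0) \<and> (\<forall>p. tagged_partition p \<and> delta_fine \<delta> p \<longrightarrow>
        norm (v + w - riemann_point (\<lambda>t. f t + g t) p) < \<epsilon>)" by blast
  qed
qed

lemma mcshane_imp_henstock_integrable: "mcshane_integrable f \<Longrightarrow> henstock_integrable f"
  unfolding mcshane_integrable_def henstock_integrable_def
    has_henstock_integral_multi_iff has_mcshane_integral_multi_iff
  using integral_over_mono[OF perron_le_tagged] by blast

theorem proposition3p1:
  assumes "\<And>f :: real \<Rightarrow> 'a::banach. pettis_integrable f \<longleftrightarrow> mcshane_integrable f"
  shows "(\<forall>\<Gamma> :: real \<Rightarrow> 'a set. (\<forall>t\<in>{0..1}. \<Gamma> t \<in> cwk) \<longrightarrow> henstock_integrable_multi \<Gamma> \<longrightarrow>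
            (\<forall>f. selection_of f \<Gamma> \<and> scalarly_measurable f \<longrightarrow> henstock_integrable f)) \<and>
         (\<forall>\<Gamma> :: real \<Rightarrow> 'a set. (\<forall>t\<in>{0..1}. \<Gamma> t \<in> cwk) \<longrightarrow> mcshane_integrable_multi \<Gamma> \<longrightarrow>
            (\<forall>f. selection_of f \<Gamma> \<and> scalarly_measurable f \<longrightarrow> mcshane_integrable f))"
proof -
  have decomposition: "\<exists>f v. integral_over P (\<lambda>t. {f t}) {v} \<and> mcshane_integrable (\<lambda>t. g t - f t)"
    if P: "P \<le> tagged_partition" "perron_partition \<le> P"
      and \<Gamma>: "\<forall>t\<in>{0..1}. \<Gamma> t \<in> cwk" "integral_over P \<Gamma> \<Phi>"
      and g: "selection_of g \<Gamma>" "scalarly_measurable g"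
    for P and \<Gamma> :: "real \<Rightarrow> 'a set" and \<Phi> g
  proof -
    have \<Gamma>': "\<And>t. t \<in> {0..1} \<Longrightarrow> \<Gamma> t \<in> cwk" using \<Gamma>(1) by blast
    obtain f v where f: "selection_of f \<Gamma>" "integral_over P (\<lambda>t. {f t}) {v}"
      using integrable_selection_exists[OF P \<Gamma>' \<Gamma>(2)] by blast
    have "(f has_integral v) {0..1}"
      using integral_over_mono[OF P(2) f(2)] by (rule integral_over_perron_imp_has_integral)
    from difference_of_selections_pettis[OF P \<Gamma>' \<Gamma>(2) f(1) this g]
    have "mcshane_integrable (\<lambda>t. g t - f t)" using assms by blast
    with f(2) show ?thesis by blast
  qed
  show ?thesis
  proof (intro conjI allI impI; elim conjE)
    fix \<Gamma> :: "real \<Rightarrow> 'a set" and g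
    assume \<Gamma>: "\<forall>t\<in>{0..1}. \<Gamma> t \<in> cwk" "henstock_integrable_multi \<Gamma>"
      and g: "selection_of g \<Gamma>" "scalarly_measurable g"
    obtain \<Phi> where \<Phi>: "integral_over perron_partition \<Gamma> \<Phi>"
      using \<Gamma>(2) by (auto simp: henstock_integrable_multi_def has_henstock_integral_multi_iff)
    obtain f v where f: "integral_over perron_partition (\<lambda>t. {f t}) {v}" "mcshane_integrable (\<lambda>t. g t - f t)"
      using decomposition[OF perron_le_tagged order_refl \<Gamma>(1) \<Phi> g] by blast
    have "henstock_integrable f"
      using f(1) by (auto simp: henstock_integrable_def has_henstock_integral_multi_iff)
    from henstock_integrable_add[OF this mcshane_imp_henstock_integrable[OF f(2)]]
    show "henstock_integrable g" by simp
  next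
    fix \<Gamma> :: "real \<Rightarrow> 'a set" and g
    assume \<Gamma>: "\<forall>t\<in>{0..1}. \<Gamma> t \<in> cwk" "mcshane_integrable_multi \<Gamma>"
      and g: "selection_of g \<Gamma>" "scalarly_measurable g"
    obtain \<Phi> where \<Phi>: "integral_over tagged_partition \<Gamma> \<Phi>"
      using \<Gamma>(2) by (auto simp: mcshane_integrable_multi_def has_mcshane_integral_multi_iff)
    obtain f v where f: "integral_over tagged_partition (\<lambda>t. {f t}) {v}" "mcshane_integrable (\<lambda>t. g t - f t)"
      using decomposition[OF order_refl perron_le_tagged \<Gamma>(1) \<Phi> g] by blast
    have "mcshane_integrable f"
      using f(1) by (auto simp: mcshane_integrable_def has_mcshane_integral_multi_iff)
    from mcshane_integrable_add[OF this f(2)] show "mcshane_integrable g" by simp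
  qed
qed

end
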